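(* Let $t_0 < T < \infty$, and consider the system of $N$ agents $\dot x_i = A x_i + B u_i$, $y_i = C x_i$, $i=1,\dots,N$, with stacked initial state $x(t_0)=x_0\in\mathbb{R}^{nN}$, where $B$ and $C$ have full rank and the system $(A,B,C)$ is output controllable. Let $a_1,\dots,a_N>0$. Consider the problem of constructing a control law $u$ for the system of agents such that $y_i(T)=y_j(T)$ for all $i\neq j$, while minimizing $$\int_{t_0}^{T}\sum_{i=1}^{N}a_i u_i^T u_i\,dt .$$ The solution to this problem is, in open-loop form, $$u(t) = -\Big(L(a)\otimes \big(B^Te^{A^T(T-t)}C^TW(t_0,T)^{-1}Ce^{A(T-t_0)}\big)\Big)x_0,$$ and, in feedback form, $$u(x,t) = -\Big(L(a)\otimes \big(B^Te^{A^T(T-t)}C^TW(t,T)^{-1}Ce^{A(T-t)}\big)\Big)x .$$ Furthermore, if $\ker(C)$ is $A$-invariant, the solution to the problem is $$u(y,t) = -\Big(L(a)\otimes \big(B^TC^TG(t,T)^{-1}\big)\Big)y,$$ or equivalently, for each $i=1,\dots,N$, $$u_i(y,t) = B^TC^TG(t,T)^{-1}\sum_{j=1}^N \alpha a_j (y_j - y_i),\qquad \alpha = \Big(\sum_{i=1}^N a_i\Big)^{-1}.$$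
   Context: Here $x_i(t)\in\mathbb{R}^n$, $u_i(t)\in\mathbb{R}^m$, $y_i(t)\in\mathbb{R}^p$, $A\in\mathbb{R}^{n\times n}$, $B\in\mathbb{R}^{n\times m}$, $C\in\mathbb{R}^{p\times n}$. Stacked vectors: $x=[x_1^T,\dots,x_N^T]^T\in\mathbb{R}^{nN}$, $u=[u_1^T,\dots,u_N^T]^T\in\mathbb{R}^{mN}$, $y=[y_1^T,\dots,y_N^T]^T\in\mathbb{R}^{pN}$; $a=[a_1,\dots,a_N]^T$. $L(a) = I_N - \big(\sum_{i=1}^N a_i\big)^{-1}1_N a^T\in\mathbb{R}^{N\times N}$, where $1_N\in\mathbb{R}^N$ is the all-ones vector. $\otimes$ is the Kronecker product. $W(t,T)=\int_t^T Ce^{A(T-s)}BB^Te^{A^T(T-s)}C^T\,ds$ is the output controllability Gramian; output controllability means that $W(t,T)$ is nonsingular for $t<T$. $G(t,T)=\int_0^{T-t}Ce^{-Ar}BB^Te^{-A^Tr}C^T\,dr$. A superscript $T$ on a matrix or vector denotes transpose; $T$ as an argument, in an integration limit, or in $T-t$ denotes the terminal time. The admissible controls are the functions $u:[t_0,T]\to\mathbb{R}^{mN}$ for which the Lebesgue integral $\int_{t_0}^T\sum_i a_i u_i^Tu_i\,dt$ converges. No communication constraints are imposed. The feedback laws are applied on $[t_0,T)$, with the value of $u$ at $T$ given by the limit as $t\uparrow T$. *)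

theory Defs
  imports "HOL-Analysis.Analysis"
begin

section \<open>Matrices\<close>

text \<open>
  On \<^typ>\<open>real^'n^'n\<close> the class operations \<^term>\<open>(*)\<close>, \<^term>\<open>(^)\<close> and \<^term>\<open>1\<close> are
  componentwise, and the generic \<^const>\<open>exp\<close> is not available, so the exponential series is
  written out with the matrix product and the identity matrix \<^term>\<open>mat 1\<close>.
\<close>

definition mat_exp :: "real^'n^'n \<Rightarrow> real^'n^'n" where
  "mat_exp A = (\<Sum>k. (1 / fact k) *\<^sub>R (((**) A ^^ k) (mat 1)))"

text \<open>
  A stacked vector in $\mathbb{R}^{kN}$ is a vector indexed by pairs (agent, component).
  The Kronecker product is indexed accordingly, the first factor acting on the agents.
\<close>

definition kron :: "real^'b^'a \<Rightarrow> real^'d^'c \<Rightarrow> real^('b \<times> 'd)^('a \<times> 'c)" where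
  "kron M K = (\<chi> q r. M $ fst q $ fst r * K $ snd q $ snd r)"

definition stack :: "('a::finite \<Rightarrow> real^'k) \<Rightarrow> real^('a \<times> 'k)" where
  "stack f = (\<chi> q. f (fst q) $ snd q)"

definition agent :: "real^('a::finite \<times> 'k) \<Rightarrow> 'a \<Rightarrow> real^'k" where
  "agent x i = (\<chi> k. x $ (i, k))"

lemma agent_stack [simp]: "agent (stack f) i = f i"
  by (simp add: agent_def stack_def vec_eq_iff)

lemma stack_agent [simp]: "stack (agent x) = x"
  by (simp add: agent_def stack_def vec_eq_iff)

lemma agent_kron:
  fixes x :: "real^('b::finite \<times> 'd::finite)"
  shows "agent (kron M K *v x) i = (\<Sum>j\<in>UNIV. (M $ i $ j) *\<^sub>R (K *v agent x j))"
  by (simp add: agent_def kron_def vec_eq_iff matrix_vector_mult_def sum_distrib_left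
      mult.assoc sum.cartesian_product case_prod_beta)

text \<open>Here \<^term>\<open>1 :: real^'a\<close> is the all-ones vector.\<close>

definition weighted_laplacian :: "real^'a \<Rightarrow> real^'a^'a" where
  "weighted_laplacian a =
     mat 1 - inverse (\<Sum>i\<in>UNIV. a $ i) *\<^sub>R
       ((columnvector 1 :: real^1^'a) ** (rowvector a :: real^'a^1))"

section \<open>Gramians\<close>

definition out_gramian ::
    "real^'n^'n \<Rightarrow> real^'m^'n \<Rightarrow> real^'n^'p \<Rightarrow> real \<Rightarrow> real \<Rightarrow> real^'p^'p" where
  "out_gramian A B C t T =
     integral {t..T} (\<lambda>s. C ** mat_exp ((T - s) *\<^sub>R A) ** B ** transpose B **
                          mat_exp ((T - s) *\<^sub>R transpose A) ** transpose C)"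

definition out_controllable :: "real^'n^'n \<Rightarrow> real^'m^'n \<Rightarrow> real^'n^'p \<Rightarrow> bool" where
  "out_controllable A B C \<longleftrightarrow> (\<forall>t T. t < T \<longrightarrow> invertible (out_gramian A B C t T))"

definition backward_gramian ::
    "real^'n^'n \<Rightarrow> real^'m^'n \<Rightarrow> real^'n^'p \<Rightarrow> real \<Rightarrow> real \<Rightarrow> real^'p^'p" where
  "backward_gramian A B C t T =
     integral {0..T - t} (\<lambda>r. C ** mat_exp (- (r *\<^sub>R A)) ** B ** transpose B **
                              mat_exp (- (r *\<^sub>R transpose A)) ** transpose C)"

section \<open>The optimal control problem\<close>

text \<open>
  Solutions of $\dot x_i = A x_i + B u_i$, $x(t_0) = x_0$, on a time set \<open>S\<close> (an interval with
  left end point \<open>t0\<close>) in the sense of Caratheodory, since admissible controls are merely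
  measurable.
\<close>

definition trajectory ::
    "real^'n^'n \<Rightarrow> real^'m^'n \<Rightarrow> real \<Rightarrow> real^('a::finite \<times> 'n) \<Rightarrow> real set \<Rightarrow>
     (real \<Rightarrow> real^('a \<times> 'm)) \<Rightarrow> (real \<Rightarrow> real^('a \<times> 'n)) \<Rightarrow> bool" where
  "trajectory A B t0 x0 S u x \<longleftrightarrow>
     (\<forall>t\<in>S. \<forall>i.
        (\<lambda>s. A *v agent (x s) i + B *v agent (u s) i) absolutely_integrable_on {t0..t} \<and>
        agent (x t) i =
          agent x0 i + integral {t0..t} (\<lambda>s. A *v agent (x s) i + B *v agent (u s) i))"

definition stacked_output :: "real^'n^'p \<Rightarrow> real^('a::finite \<times> 'n) \<Rightarrow> real^('a \<times> 'p)" where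
  "stacked_output C x = stack (\<lambda>i. C *v agent x i)"

definition run_cost :: "real^'a \<Rightarrow> real^('a \<times> 'm::finite) \<Rightarrow> real" where
  "run_cost a v = (\<Sum>i\<in>UNIV. a $ i * (agent v i \<bullet> agent v i))"

definition cost :: "real^'a \<Rightarrow> real \<Rightarrow> real \<Rightarrow> (real \<Rightarrow> real^('a \<times> 'm::finite)) \<Rightarrow> real" where
  "cost a t0 T u = (LINT t:{t0..T}|lebesgue. run_cost a (u t))"

definition admissible :: "real^'a \<Rightarrow> real \<Rightarrow> real \<Rightarrow> (real \<Rightarrow> real^('a \<times> 'm::finite)) \<Rightarrow> bool" where
  "admissible a t0 T u \<longleftrightarrow>
     u \<in> borel_measurable (lebesgue_on {t0..T}) \<and>
     set_integrable lebesgue {t0..T} (\<lambda>t. run_cost a (u t))"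

definition feasible ::
    "real^'n^'n \<Rightarrow> real^'m^'n \<Rightarrow> real^'n^'p \<Rightarrow> real^'a \<Rightarrow> real \<Rightarrow> real \<Rightarrow> real^('a \<times> 'n) \<Rightarrow>
     (real \<Rightarrow> real^('a \<times> 'm)) \<Rightarrow> bool" where
  "feasible A B C a t0 T x0 u \<longleftrightarrow>
     admissible a t0 T u \<and>
     (\<exists>x. trajectory A B t0 x0 {t0..T} u x \<and>
          (\<forall>i j. i \<noteq> j \<longrightarrow> agent (stacked_output C (x T)) i = agent (stacked_output C (x T)) j))"

definition optimal ::
    "real^'n^'n \<Rightarrow> real^'m^'n \<Rightarrow> real^'n^'p \<Rightarrow> real^'a \<Rightarrow> real \<Rightarrow> real \<Rightarrow> real^('a \<times> 'n) \<Rightarrow>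
     (real \<Rightarrow> real^('a \<times> 'm)) \<Rightarrow> bool" where
  "optimal A B C a t0 T x0 u \<longleftrightarrow>
     feasible A B C a t0 T x0 u \<and>
     (\<forall>v. feasible A B C a t0 T x0 v \<longrightarrow> cost a t0 T u \<le> cost a t0 T v)"

text \<open>The solution of the problem: controls that agree almost everywhere are identified.\<close>

definition the_solution ::
    "real^'n^'n \<Rightarrow> real^'m^'n \<Rightarrow> real^'n^'p \<Rightarrow> real^'a \<Rightarrow> real \<Rightarrow> real \<Rightarrow> real^('a \<times> 'n) \<Rightarrow>
     (real \<Rightarrow> real^('a \<times> 'm)) \<Rightarrow> bool" where
  "the_solution A B C a t0 T x0 u \<longleftrightarrow>
     optimal A B C a t0 T x0 u \<and>
     (\<forall>v. optimal A B C a t0 T x0 v \<longrightarrow> (AE t in lebesgue_on {t0..T}. v t = u t))"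

text \<open>
  A state feedback law is applied on $[t_0,T)$, as the Gramians are singular at $t = T$; the value
  of the resulting control at \<open>T\<close> is its left limit.
\<close>

definition feedback_solution ::
    "real^'n^'n \<Rightarrow> real^'m^'n \<Rightarrow> real^'n^'p \<Rightarrow> real^'a \<Rightarrow> real \<Rightarrow> real \<Rightarrow> real^('a \<times> 'n) \<Rightarrow>
     (real^('a \<times> 'n) \<Rightarrow> real \<Rightarrow> real^('a \<times> 'm)) \<Rightarrow> bool" where
  "feedback_solution A B C a t0 T x0 law \<longleftrightarrow>
     (\<exists>x. trajectory A B t0 x0 {t0..<T} (\<lambda>t. law (x t) t) x) \<and>
     (\<forall>x. trajectory A B t0 x0 {t0..<T} (\<lambda>t. law (x t) t) x \<longrightarrow>
        (\<exists>l. ((\<lambda>t. law (x t) t) \<longlongrightarrow> l) (at_left T) \<and>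
             the_solution A B C a t0 T x0 (\<lambda>t. if t < T then law (x t) t else l)))"

definition output_feedback_solution ::
    "real^'n^'n \<Rightarrow> real^'m^'n \<Rightarrow> real^'n^'p \<Rightarrow> real^'a \<Rightarrow> real \<Rightarrow> real \<Rightarrow> real^('a \<times> 'n) \<Rightarrow>
     (real^('a \<times> 'p) \<Rightarrow> real \<Rightarrow> real^('a \<times> 'm)) \<Rightarrow> bool" where
  "output_feedback_solution A B C a t0 T x0 law \<longleftrightarrow>
     feedback_solution A B C a t0 T x0 (\<lambda>x t. law (stacked_output C x) t)"

section \<open>The control laws\<close>

definition open_loop_control ::
    "real^'n^'n \<Rightarrow> real^'m^'n \<Rightarrow> real^'n^'p \<Rightarrow> real^'a \<Rightarrow> real \<Rightarrow> real \<Rightarrow> real^('a \<times> 'n) \<Rightarrow>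
     real \<Rightarrow> real^('a \<times> 'm)" where
  "open_loop_control A B C a t0 T x0 t =
     - (kron (weighted_laplacian a)
          (transpose B ** mat_exp ((T - t) *\<^sub>R transpose A) ** transpose C **
           matrix_inv (out_gramian A B C t0 T) ** C ** mat_exp ((T - t0) *\<^sub>R A)) *v x0)"

definition state_feedback ::
    "real^'n^'n \<Rightarrow> real^'m^'n \<Rightarrow> real^'n^'p \<Rightarrow> real^'a \<Rightarrow> real \<Rightarrow>
     real^('a \<times> 'n) \<Rightarrow> real \<Rightarrow> real^('a \<times> 'm)" where
  "state_feedback A B C a T x t =
     - (kron (weighted_laplacian a)
          (transpose B ** mat_exp ((T - t) *\<^sub>R transpose A) ** transpose C **
           matrix_inv (out_gramian A B C t T) ** C ** mat_exp ((T - t) *\<^sub>R A)) *v x)"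

definition output_feedback ::
    "real^'n^'n \<Rightarrow> real^'m^'n \<Rightarrow> real^'n^'p \<Rightarrow> real^'a \<Rightarrow> real \<Rightarrow>
     real^('a \<times> 'p) \<Rightarrow> real \<Rightarrow> real^('a \<times> 'm)" where
  "output_feedback A B C a T y t =
     - (kron (weighted_laplacian a)
          (transpose B ** transpose C ** matrix_inv (backward_gramian A B C t T)) *v y)"

definition agent_feedback ::
    "real^'n^'n \<Rightarrow> real^'m^'n \<Rightarrow> real^'n^'p \<Rightarrow> real^'a \<Rightarrow> real \<Rightarrow>
     real^('a \<times> 'p) \<Rightarrow> real \<Rightarrow> 'a \<Rightarrow> real^'m" where
  "agent_feedback A B C a T y t i =
     (let \<alpha> = inverse (\<Sum>k\<in>UNIV. a $ k) in
      (transpose B ** transpose C ** matrix_inv (backward_gramian A B C t T)) *v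
        (\<Sum>j\<in>UNIV. (\<alpha> * a $ j) *\<^sub>R (agent y j - agent y i)))"

end

theory Submission
  imports Defs
begin

text \<open>
  Write $\Phi(t) = Ce^{A(T-t)}B$ and $z_i(t) = Ce^{A(T-t)}x_i(t)$, the output that agent \<open>i\<close> would have at time
  \<open>T\<close> if its control were switched off at time \<open>t\<close>. Along any trajectory
  $z_i(t) = z_i(t_0) + \int_{t_0}^t \Phi u_i$
  (\<open>terminal_output_has_integral\<close>), so the terminal constraint only sees the vectors
  $\int \Phi u_i$.

  Let $e_i$ be the deviation of $z_i$ from its weighted mean over the agents, and
  $q_i = W(t,T)^{-1}e_i$. The open-loop law is $u_i = -\Phi^Tq_i$ with $q_i$ taken at $t_0$. It
  gives $e_i(t) = W(t,T)q_i$, which is zero at \<open>T\<close>, so the outputs agree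
  (\<open>open_loop_control_feasible\<close>). If \<open>v\<close> is another feasible control, then
  $\int u_i\cdot(v_i - u_i) = -q_i\cdot d$, where \<open>d\<close> is the difference of the
  two common terminal outputs; as $\sum_i a_iq_i = 0$, the weighted cross term vanishes and
  $J(v) = J(u) + J(v-u)$. Optimality and uniqueness follow at once
  (\<open>the_solution_of_orthogonality\<close>, \<open>open_loop_control_solution\<close>).

  The state feedback law uses $q_i$ taken at the current time. Along any closed-loop trajectory
  $e_i' = -\Phi\Phi^TW^{-1}e_i = W'W^{-1}e_i$, hence $W^{-1}e_i$ is constant
  (\<open>closed_loop_steering_constant\<close>) and the feedback produces the open-loop control.

  If the kernel of \<open>C\<close> is invariant under \<open>A\<close>, then $CA = A'C$ for some $A'$ and
  $G(t,T) = e^{-A'(T-t)}\,W(t,T)\,(e^{-A'(T-t)})^T$. Substituting this into the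
  output feedback law gives the state feedback law
  (\<open>output_feedback_eq_state_feedback\<close>).
\<close>

section \<open>The matrix exponential\<close>

lemma bounded_bilinear_matrix_matrix_mult:
  "bounded_bilinear ((**) :: real^'n^'m \<Rightarrow> real^'p^'n \<Rightarrow> real^'p^'m)"
  by (subst bilinear_conv_bounded_bilinear[symmetric])
     (auto simp: bilinear_def linear_iff matrix_add_ldistrib matrix_matrix_mult_def vec_eq_iff
        algebra_simps sum.distrib sum_distrib_left)

lemma bounded_bilinear_matrix_vector_mult:
  "bounded_bilinear ((*v) :: real^'n^'m \<Rightarrow> real^'n \<Rightarrow> real^'m)"
  by (subst bilinear_conv_bounded_bilinear[symmetric])
     (auto simp: bilinear_def linear_iff matrix_vector_mult_def vec_eq_iff
        algebra_simps sum.distrib sum_distrib_left)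

interpretation matmul: bounded_bilinear "(**) :: real^'n^'m \<Rightarrow> real^'p^'n \<Rightarrow> real^'p^'m"
  by (rule bounded_bilinear_matrix_matrix_mult)

interpretation matvec: bounded_bilinear "(*v) :: real^'n^'m \<Rightarrow> real^'n \<Rightarrow> real^'m"
  by (rule bounded_bilinear_matrix_vector_mult)

lemma bounded_linear_transpose:
  "bounded_linear (transpose :: real^'n^'m \<Rightarrow> real^'m^'n)"
  by (subst linear_conv_bounded_linear[symmetric])
     (auto simp: linear_iff transpose_def vec_eq_iff)

definition mat_pow :: "real^'n^'n \<Rightarrow> nat \<Rightarrow> real^'n^'n" where
  "mat_pow A k = ((**) A ^^ k) (mat 1)"

lemma mat_pow_0 [simp]: "mat_pow A 0 = mat 1"
  and mat_pow_Suc: "mat_pow A (Suc k) = A ** mat_pow A k"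
  by (simp_all add: mat_pow_def)

lemma mat_pow_scaleR: "mat_pow (t *\<^sub>R A) k = t ^ k *\<^sub>R mat_pow A k"
  by (induction k) (simp_all add: mat_pow_Suc matmul.scaleR_left matmul.scaleR_right)

text \<open>
  The matrix norm is submultiplicative up to a constant \<open>K\<close>, so the series is dominated by a scalar
  exponential series with argument $|t|\,|A|\,K$.
\<close>

lemma mat_exp_sums:
  fixes A :: "real^'n^'n"
  shows "(\<lambda>k. (t ^ k / fact k) *\<^sub>R mat_pow A k) sums mat_exp (t *\<^sub>R A)"
proof -
  obtain K where K: "K > 0" "\<And>(X :: real^'n^'n) (Y :: real^'n^'n). norm (X ** Y) \<le> norm X * norm Y * K"
    using matmul.pos_bounded by blast
  have bound: "norm (mat_pow A k) \<le> (norm A * K) ^ k * norm (mat 1 :: real^'n^'n)" for k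
  proof (induction k)
    case (Suc k)
    have "norm (mat_pow A (Suc k)) \<le> norm A * norm (mat_pow A k) * K"
      by (simp add: mat_pow_Suc K)
    also have "\<dots> \<le> norm A * ((norm A * K) ^ k * norm (mat 1 :: real^'n^'n)) * K"
      using Suc K(1) by (intro mult_right_mono mult_left_mono) auto
    finally show ?case by (simp add: mult_ac)
  qed simp
  let ?g = "\<lambda>k. norm (mat 1 :: real^'n^'n) * (inverse (fact k) * (\<bar>t\<bar> * (norm A * K)) ^ k)"
  have "summable ?g"
    by (intro summable_mult summable_exp)
  then have "summable (\<lambda>k. (t ^ k / fact k) *\<^sub>R mat_pow A k)"
  proof (rule summable_comparison_test'[where N = 0])
    fix k :: nat
    have "norm ((t ^ k / fact k) *\<^sub>R mat_pow A k) = (\<bar>t\<bar> ^ k / fact k) * norm (mat_pow A k)"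
      by (simp add: power_abs)
    also have "\<dots> \<le> (\<bar>t\<bar> ^ k / fact k) * ((norm A * K) ^ k * norm (mat 1 :: real^'n^'n))"
      by (intro mult_left_mono bound) auto
    finally show "norm ((t ^ k / fact k) *\<^sub>R mat_pow A k) \<le> ?g k"
      by (simp add: power_mult_distrib field_simps)
  qed
  moreover have "mat_exp (t *\<^sub>R A) = (\<Sum>k. (t ^ k / fact k) *\<^sub>R mat_pow A k)"
    by (simp add: mat_exp_def mat_pow_def[symmetric] mat_pow_scaleR field_simps)
  ultimately show ?thesis
    by (simp add: summable_sums)
qed

lemma mat_exp_0 [simp]: "mat_exp (0 :: real^'n^'n) = mat 1"
proof -
  have "(\<lambda>k. (0 ^ k / fact k) *\<^sub>R mat_pow (0 :: real^'n^'n) k) sums mat 1"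
    using sums_finite[of "{0}" "\<lambda>k. (0 ^ k / fact k) *\<^sub>R mat_pow (0 :: real^'n^'n) k"] by simp
  then show ?thesis
    using mat_exp_sums[of 0 "0 :: real^'n^'n"] sums_unique2 by fastforce
qed

lemma vec_nth_sums:
  fixes f :: "nat \<Rightarrow> real^'n^'m"
  assumes "f sums s"
  shows "(\<lambda>k. f k $ i $ j) sums (s $ i $ j)"
  using assms by (intro bounded_linear.sums[OF bounded_linear_vec_nth])

text \<open>
  Each entry of $e^{tA}$ is an everywhere convergent real power series in $t$, so it may be
  differentiated term by term; the shifted coefficients are the entries of $A \cdot A^k/k!$.
\<close>

lemma mat_exp_has_vector_derivative:
  fixes A :: "real^'n^'n"
  shows "((\<lambda>t. mat_exp (t *\<^sub>R A)) has_vector_derivative A ** mat_exp (t *\<^sub>R A)) (at t within S)"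
proof -
  have "((\<lambda>t. mat_exp (t *\<^sub>R A) $ i $ j) has_real_derivative (A ** mat_exp (t *\<^sub>R A)) $ i $ j) (at t)"
    for i j
  proof -
    define c where "c = (\<lambda>k. mat_pow A k $ i $ j / fact k)"
    have entry: "(\<lambda>k. c k * s ^ k) sums (mat_exp (s *\<^sub>R A) $ i $ j)" for s
      using vec_nth_sums[OF mat_exp_sums[of s A], of i j] by (simp add: c_def mult_ac)
    have "(\<lambda>k. A ** ((t ^ k / fact k) *\<^sub>R mat_pow A k)) sums (A ** mat_exp (t *\<^sub>R A))"
      by (intro bounded_linear.sums[OF matmul.bounded_linear_right] mat_exp_sums)
    from vec_nth_sums[OF this, of i j]
    have "(\<lambda>k. diffs c k * t ^ k) sums ((A ** mat_exp (t *\<^sub>R A)) $ i $ j)"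
      by (simp add: diffs_def c_def mat_pow_Suc matmul.scaleR_right mult_ac del: of_nat_Suc)
    then show ?thesis
      using termdiffs_strong_converges_everywhere[of c t] entry
      by (simp add: sums_iff)
  qed
  then have "((\<lambda>t. mat_exp (t *\<^sub>R A) $ i $ j) has_vector_derivative (A ** mat_exp (t *\<^sub>R A)) $ i $ j)
      (at t within S)" for i j
    by (simp add: has_real_derivative_iff_has_vector_derivative has_vector_derivative_at_within)
  then have "((\<lambda>t. mat_exp (t *\<^sub>R A)) has_derivative (\<lambda>x. x *\<^sub>R (A ** mat_exp (t *\<^sub>R A)))) (at t within S)"
    unfolding has_vector_derivative_def
    by (subst has_derivative_componentwise_within)
       (auto simp: Basis_vec_def inner_axis )
  then show ?thesis by (simp add: has_vector_derivative_def)
qed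

lemma mat_exp_commute:
  fixes A :: "real^'n^'n"
  shows "A ** mat_exp (t *\<^sub>R A) = mat_exp (t *\<^sub>R A) ** A"
proof -
  have comm: "A ** mat_pow A k = mat_pow A k ** A" for k
    by (induction k) (simp, metis mat_pow_Suc matrix_mul_assoc)
  have "(\<lambda>k. A ** ((t ^ k / fact k) *\<^sub>R mat_pow A k)) sums (A ** mat_exp (t *\<^sub>R A))"
    by (intro bounded_linear.sums[OF matmul.bounded_linear_right] mat_exp_sums)
  moreover have "(\<lambda>k. ((t ^ k / fact k) *\<^sub>R mat_pow A k) ** A) sums (mat_exp (t *\<^sub>R A) ** A)"
    by (intro bounded_linear.sums[OF matmul.bounded_linear_left] mat_exp_sums)
  ultimately show ?thesis
    by (simp add: comm matmul.scaleR_left matmul.scaleR_right sums_unique2)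
qed

lemma mat_exp_has_vector_derivative_affine:
  fixes A :: "real^'n^'n"
  assumes "(g has_real_derivative c) (at t within S)"
  shows "((\<lambda>t. mat_exp (g t *\<^sub>R A)) has_vector_derivative c *\<^sub>R (A ** mat_exp (g t *\<^sub>R A)))
    (at t within S)"
  using vector_diff_chain_within[OF assms[unfolded has_real_derivative_iff_has_vector_derivative]
      mat_exp_has_vector_derivative]
  by (simp add: o_def)

lemma continuous_on_mat_exp:
  fixes A :: "real^'n^'n"
  assumes "continuous_on S g"
  shows "continuous_on S (\<lambda>t. mat_exp (g t *\<^sub>R A))"
proof -
  have "continuous_on UNIV (\<lambda>t. mat_exp (t *\<^sub>R A))"
    by (intro continuous_at_imp_continuous_on ballI
        has_vector_derivative_continuous[OF mat_exp_has_vector_derivative])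
  from continuous_on_compose2[OF this assms] show ?thesis by simp
qed

text \<open>
  The product rule makes the derivative of $e^{-tA}\,Y(t)$ vanish, because \<open>A\<close> commutes with its
  exponential. All algebraic identities for \<^const>\<open>mat_exp\<close> below (inverse, addition, transposition,
  intertwining) are uniqueness statements obtained from this one computation.
\<close>

lemma mat_exp_minus_mult_ode_solution:
  fixes A :: "real^'n^'n" and Y :: "real \<Rightarrow> real^'p^'n"
  assumes "\<And>t. (Y has_vector_derivative A ** Y t) (at t)"
  shows "mat_exp (- (t *\<^sub>R A)) ** Y t = Y 0"
proof -
  let ?h = "\<lambda>t. mat_exp ((- t) *\<^sub>R A) ** Y t"
  have "(?h has_vector_derivative 0) (at t within UNIV)" for t
  proof -
    have "((\<lambda>t. mat_exp ((- t) *\<^sub>R A)) has_vector_derivative - 1 *\<^sub>R (A ** mat_exp ((- t) *\<^sub>R A)))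
        (at t within UNIV)"
      by (rule mat_exp_has_vector_derivative_affine) (auto intro!: derivative_eq_intros)
    from matmul.has_vector_derivative[OF this assms]
    show ?thesis
      by (simp add: matmul.minus_left matrix_mul_assoc mat_exp_commute[of A "- t", simplified])
  qed
  then obtain c where c: "\<And>t. ?h t = c"
    using has_vector_derivative_zero_constant[of UNIV ?h] by auto
  from c[of 0] c[of t] show ?thesis by simp
qed

lemma mat_exp_inverse:
  fixes A :: "real^'n^'n"
  shows "mat_exp (- (t *\<^sub>R A)) ** mat_exp (t *\<^sub>R A) = mat 1"
  using mat_exp_minus_mult_ode_solution[of "\<lambda>t. mat_exp (t *\<^sub>R A)" A,
      OF mat_exp_has_vector_derivative] by simp

lemma mat_exp_inverse':
  fixes A :: "real^'n^'n"
  shows "mat_exp (t *\<^sub>R A) ** mat_exp (- (t *\<^sub>R A)) = mat 1"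
  using mat_exp_inverse[of "- t" A] by simp

lemma linear_ode_solution_unique:
  fixes A :: "real^'n^'n" and Y :: "real \<Rightarrow> real^'p^'n"
  assumes "\<And>t. (Y has_vector_derivative A ** Y t) (at t)"
  shows "Y t = mat_exp (t *\<^sub>R A) ** Y 0"
  unfolding mat_exp_minus_mult_ode_solution[of Y A t, OF assms, symmetric]
  by (simp add: matrix_mul_assoc mat_exp_inverse')

lemma mat_exp_intertwine:
  fixes A :: "real^'n^'n" and A' :: "real^'p^'p" and C :: "real^'n^'p"
  assumes "C ** A = A' ** C"
  shows "C ** mat_exp (t *\<^sub>R A) = mat_exp (t *\<^sub>R A') ** C"
proof -
  have "((\<lambda>t. C ** mat_exp (t *\<^sub>R A)) has_vector_derivative A' ** (C ** mat_exp (t *\<^sub>R A))) (at t)" for t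
    using bounded_linear.has_vector_derivative[OF matmul.bounded_linear_right
        mat_exp_has_vector_derivative, of C A t UNIV]
    by (simp add: matrix_mul_assoc assms)
  from linear_ode_solution_unique[of "\<lambda>t. C ** mat_exp (t *\<^sub>R A)", OF this] show ?thesis
    by simp
qed

lemma mat_exp_add:
  fixes A :: "real^'n^'n"
  shows "mat_exp ((s + t) *\<^sub>R A) = mat_exp (s *\<^sub>R A) ** mat_exp (t *\<^sub>R A)"
proof -
  have "((\<lambda>s. mat_exp ((s + t) *\<^sub>R A)) has_vector_derivative 1 *\<^sub>R (A ** mat_exp ((s + t) *\<^sub>R A))) (at s)" for s
    by (rule mat_exp_has_vector_derivative_affine) (auto intro!: derivative_eq_intros)
  then show ?thesis
    using linear_ode_solution_unique[of "\<lambda>s. mat_exp ((s + t) *\<^sub>R A)" A s] by simp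
qed

lemma mat_exp_transpose:
  fixes A :: "real^'n^'n"
  shows "mat_exp (t *\<^sub>R transpose A) = transpose (mat_exp (t *\<^sub>R A))"
proof -
  have "((\<lambda>t. transpose (mat_exp (t *\<^sub>R A))) has_vector_derivative
      transpose A ** transpose (mat_exp (t *\<^sub>R A))) (at t)" for t
    using bounded_linear.has_vector_derivative[OF bounded_linear_transpose
        mat_exp_has_vector_derivative, of A t UNIV]
    by (simp add: mat_exp_commute matrix_transpose_mul)
  from linear_ode_solution_unique[of "\<lambda>t. transpose (mat_exp (t *\<^sub>R A))", OF this] show ?thesis
    by simp
qed

section \<open>Integration by parts against an indefinite integral\<close>

lemma absolutely_integrable_inner_continuous:
  fixes f g :: "real \<Rightarrow> 'e::euclidean_space"
  assumes g: "continuous_on {a..b} g" and f: "f absolutely_integrable_on {a..b}"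
  shows "(\<lambda>t. g t \<bullet> f t) absolutely_integrable_on {a..b}"
proof (rule absolutely_integrable_bounded_measurable_product[where h = "(\<bullet>)"])
  show "bilinear ((\<bullet>) :: 'e \<Rightarrow> 'e \<Rightarrow> real)"
    by (subst bilinear_conv_bounded_bilinear) (rule bounded_bilinear_inner)
  show "g \<in> borel_measurable (lebesgue_on {a..b})"
    by (rule continuous_imp_measurable_on_sets_lebesgue[OF g]) simp
  show "bounded (g ` {a..b})"
    by (rule compact_imp_bounded[OF compact_continuous_image[OF g compact_Icc]])
qed (use f in simp_all)

text \<open>
  Since admissible controls are merely measurable, states are only indefinite integrals
  $F(t) = F(a) + \int_a^t f$ and need not be differentiable at every point. Still, the difference of the two sides,
  $D(t) = \xi(t)\cdot F(t) - \int_a^t \xi\cdot f - \int_a^t \xi'\cdot F$, is differentiable at \<^emph>\<open>every\<close>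
  point with derivative zero: the rough part of $D(s) - D(t)$ is
  $\int_t^s (\xi(s) - \xi(r))\cdot f(r)\,dr$, and it is at most
  $K\,|s-t|\,\int_t^s |f|$ when \<open>K\<close> bounds $|\xi'|$. The last factor tends to zero, so this part is
  $o(|s-t|)$.
\<close>

lemma integration_by_parts_inner:
  fixes \<xi> \<xi>' f F :: "real \<Rightarrow> 'e::euclidean_space"
  assumes "a \<le> b"
    and deriv: "\<And>t. t \<in> {a..b} \<Longrightarrow> (\<xi> has_vector_derivative \<xi>' t) (at t within {a..b})"
    and cont': "continuous_on {a..b} \<xi>'"
    and f: "f absolutely_integrable_on {a..b}"
    and F: "\<And>t. t \<in> {a..b} \<Longrightarrow> F t = F a + integral {a..t} f"
  shows "(\<lambda>t. \<xi> t \<bullet> f t) absolutely_integrable_on {a..b}"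
    and "integral {a..b} (\<lambda>t. \<xi>' t \<bullet> F t + \<xi> t \<bullet> f t) = \<xi> b \<bullet> F b - \<xi> a \<bullet> F a"
proof -
  have contF: "continuous_on {a..b} F"
  proof (rule continuous_on_eq)
    show "continuous_on {a..b} (\<lambda>t. F a + integral {a..t} f)"
      by (intro continuous_on_add continuous_on_const indefinite_integral_continuous_1
          set_lebesgue_integral_eq_integral(1)[OF f])
  qed (rule F[symmetric])
  have cont: "continuous_on {a..b} \<xi>"
    unfolding continuous_on_eq_continuous_within
    by (intro ballI has_vector_derivative_continuous[OF deriv])
  have fnorm: "(\<lambda>t. norm (f t)) integrable_on {a..b}" and fint: "f integrable_on {a..b}"
    using f by (auto simp: absolutely_integrable_on_def)
  have subf: "f absolutely_integrable_on {c..d}" if "{c..d} \<subseteq> {a..b}" for c d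
    by (rule absolutely_integrable_on_subinterval[OF f that])
  have mult: "(\<lambda>t. g t \<bullet> f t) absolutely_integrable_on {c..d}"
    if "continuous_on {a..b} g" "{c..d} \<subseteq> {a..b}" for g c d
    by (rule absolutely_integrable_inner_continuous[OF continuous_on_subset[OF that] subf[OF that(2)]])
  show 1: "(\<lambda>t. \<xi> t \<bullet> f t) absolutely_integrable_on {a..b}"
    by (rule mult[OF cont]) simp
  obtain K where K: "K \<ge> 0" "\<And>t. t \<in> {a..b} \<Longrightarrow> norm (\<xi>' t) \<le> K"
  proof -
    have "bounded (\<xi>' ` {a..b})"
      by (intro compact_imp_bounded compact_continuous_image cont' compact_Icc)
    then obtain K where "\<And>t. t \<in> {a..b} \<Longrightarrow> norm (\<xi>' t) \<le> K" "0 < K"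
      unfolding bounded_pos by blast
    then show ?thesis using that[of K] by simp
  qed
  have lip: "norm (\<xi> s - \<xi> r) \<le> K * \<bar>s - r\<bar>" if "s \<in> {a..b}" "r \<in> {a..b}" for s r
  proof -
    have "norm (\<xi> s - \<xi> r) \<le> K * norm (s - r)"
    proof (rule differentiable_bound[OF convex_real_interval(5) _ _ that(1,2)])
      fix t assume t: "t \<in> {a..b}"
      show "(\<xi> has_derivative (\<lambda>h. h *\<^sub>R \<xi>' t)) (at t within {a..b})"
        using deriv[OF t] by (simp add: has_vector_derivative_def)
      show "onorm (\<lambda>h. h *\<^sub>R \<xi>' t) \<le> K"
      proof (rule onorm_le)
        fix h :: real
        show "norm (h *\<^sub>R \<xi>' t) \<le> K * norm h"
          using mult_right_mono[OF K(2)[OF t], of "norm h"] by (simp add: mult.commute)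
      qed
    qed
    then show ?thesis by simp
  qed
  define N where "N = (\<lambda>t. integral {a..t} (\<lambda>r. norm (f r)))"
  have contN: "continuous_on {a..b} N"
    unfolding N_def using fnorm by (rule indefinite_integral_continuous_1)
  have comb: "integral {a..r} g + integral {r..s} g = integral {a..s} g"
    if "a \<le> r" "r \<le> s" "s \<le> b" "g integrable_on {a..b}" for r s and g :: "real \<Rightarrow> 'z::euclidean_space"
    using that by (intro Henstock_Kurzweil_Integration.integral_combine integrable_on_subinterval[OF that(4)]) auto
  have Nmono: "N r \<le> N s" if "a \<le> r" "r \<le> s" "s \<le> b" for r s
  proof -
    have "{r..s} \<subseteq> {a..b}" using that by auto
    then have "(\<lambda>x. norm (f x)) integrable_on {r..s}"
      using fnorm integrable_on_subinterval by blast
    then have "0 \<le> integral {r..s} (\<lambda>x. norm (f x))"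
      by (rule Henstock_Kurzweil_Integration.integral_nonneg) simp
    then show ?thesis
      using comb[OF that fnorm] by (simp add: N_def)
  qed
  (* The constant c is the value of \<xi> at the point that moves, which may be either end of the interval. *)
  have est: "\<bar>integral {r..s} (\<lambda>t. (c - \<xi> t) \<bullet> f t)\<bar> \<le> K * (s - r) * (N s - N r)"
    if rs: "a \<le> r" "r \<le> s" "s \<le> b" and c: "c = \<xi> r \<or> c = \<xi> s" for r s c
  proof -
    have sub: "{r..s} \<subseteq> {a..b}" using rs by auto
    have "norm (integral {r..s} (\<lambda>t. (c - \<xi> t) \<bullet> f t)) \<le> integral {r..s} (\<lambda>t. K * (s - r) * norm (f t))"
    proof (rule integral_norm_bound_integral)
      show "(\<lambda>t. (c - \<xi> t) \<bullet> f t) integrable_on {r..s}"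
        using cont sub by (intro set_lebesgue_integral_eq_integral(1) mult continuous_intros)
      show "(\<lambda>t. K * (s - r) * norm (f t)) integrable_on {r..s}"
        using subf[OF sub] unfolding absolutely_integrable_on_def by (intro integrable_on_mult_right) auto
      fix t assume t: "t \<in> {r..s}"
      have "norm (c - \<xi> t) \<le> K * (s - r)"
      proof -
        have "norm (c - \<xi> t) \<le> K * \<bar>(if c = \<xi> r then r else s) - t\<bar>"
          using c lip[of r t] lip[of s t] t rs by auto
        also have "\<dots> \<le> K * (s - r)"
          using t K(1) by (intro mult_left_mono) auto
        finally show ?thesis .
      qed
      then show "norm ((c - \<xi> t) \<bullet> f t) \<le> K * (s - r) * norm (f t)"
        using Cauchy_Schwarz_ineq2[of "c - \<xi> t" "f t"]
        by (metis mult_right_mono norm_ge_zero order_trans real_norm_def)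
    qed
    also have "\<dots> = K * (s - r) * (N s - N r)"
      using comb[OF rs fnorm] by (simp add: N_def)
    finally show ?thesis by simp
  qed
  let ?I = "\<lambda>t. integral {a..t} (\<lambda>r. \<xi> r \<bullet> f r)"
  let ?J = "\<lambda>t. integral {a..t} (\<lambda>r. \<xi>' r \<bullet> F r)"
  define D where "D = (\<lambda>t. \<xi> t \<bullet> F t - ?I t - ?J t)"
  have "(D has_vector_derivative 0) (at t within {a..b})" if t: "t \<in> {a..b}" for t
  proof -
    define R where "R = (\<lambda>s. \<xi> s \<bullet> (F s - F t) - (?I s - ?I t))"
    have Rbound: "\<bar>R s\<bar> \<le> K * \<bar>s - t\<bar> * \<bar>N s - N t\<bar>" if s: "s \<in> {a..b}" for s
    proof -
      have const: "integral {r..r'} (\<lambda>x. \<xi> s \<bullet> f x) = \<xi> s \<bullet> integral {r..r'} f"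
        if "{r..r'} \<subseteq> {a..b}" for r r'
        using integral_linear[OF integrable_on_subinterval[OF fint that] bounded_linear_inner_right[of "\<xi> s"]]
        by (simp add: o_def)
      have diff: "integral {r..r'} (\<lambda>x. (\<xi> s - \<xi> x) \<bullet> f x) =
          \<xi> s \<bullet> integral {r..r'} f - integral {r..r'} (\<lambda>x. \<xi> x \<bullet> f x)"
        if "{r..r'} \<subseteq> {a..b}" for r r'
        unfolding inner_diff_left const[OF that, symmetric]
        by (intro Henstock_Kurzweil_Integration.integral_diff set_lebesgue_integral_eq_integral(1)
            mult continuous_intros cont that)
      show ?thesis
      proof (cases "t \<le> s")
        case True
        have le: "a \<le> t" "s \<le> b" and sub: "{t..s} \<subseteq> {a..b}" using s t by auto
        have "F s - F t = integral {t..s} f"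
          using comb[OF le(1) True le(2) fint] F[OF s] F[OF t] by (simp add: algebra_simps)
        moreover have "?I s - ?I t = integral {t..s} (\<lambda>x. \<xi> x \<bullet> f x)"
          using comb[OF le(1) True le(2) set_lebesgue_integral_eq_integral(1)[OF 1]] by (simp add: algebra_simps)
        ultimately have "R s = integral {t..s} (\<lambda>x. (\<xi> s - \<xi> x) \<bullet> f x)"
          unfolding R_def diff[OF sub] by simp
        then show ?thesis
          using est[OF le(1) True le(2), of "\<xi> s"] Nmono[OF le(1) True le(2)] True by simp
      next
        case False
        then have ts: "s \<le> t" by simp
        have le: "a \<le> s" "t \<le> b" and sub: "{s..t} \<subseteq> {a..b}" using s t by auto
        have d1: "F t - F s = integral {s..t} f"
          using comb[OF le(1) ts le(2) fint] F[OF s] F[OF t] by (simp add: algebra_simps)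
        have d2: "?I t - ?I s = integral {s..t} (\<lambda>x. \<xi> x \<bullet> f x)"
          using comb[OF le(1) ts le(2) set_lebesgue_integral_eq_integral(1)[OF 1]] by (simp add: algebra_simps)
        have "- R s = integral {s..t} (\<lambda>x. (\<xi> s - \<xi> x) \<bullet> f x)"
          unfolding R_def diff[OF sub] d1[symmetric] d2[symmetric] by (simp add: inner_diff_right)
        then have "\<bar>R s\<bar> = \<bar>integral {s..t} (\<lambda>x. (\<xi> s - \<xi> x) \<bullet> f x)\<bar>"
          by (metis abs_minus_cancel)
        then show ?thesis
          using est[OF le(1) ts le(2), of "\<xi> s"] Nmono[OF le(1) ts le(2)] ts by simp
      qed
    qed
    have "(R has_vector_derivative 0) (at t within {a..b})"
    proof -
      have lim: "((\<lambda>s. K * \<bar>N s - N t\<bar>) \<longlongrightarrow> K * \<bar>N t - N t\<bar>) (at t within {a..b})"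
        using contN t by (intro tendsto_intros) (auto simp: continuous_on_def)
      have R0: "R t = 0" by (simp add: R_def)
      show ?thesis
        unfolding has_vector_derivative_def has_derivative_within
      proof (intro conjI)
        show "bounded_linear (\<lambda>x::real. x *\<^sub>R (0::real))" by (simp add: bounded_linear_zero)
        show "((\<lambda>y. (1 / norm (y - t)) *\<^sub>R (R y - (R t + (y - t) *\<^sub>R 0))) \<longlongrightarrow> 0) (at t within {a..b})"
        proof (rule Lim_null_comparison)
          show "((\<lambda>s. K * \<bar>N s - N t\<bar>) \<longlongrightarrow> 0) (at t within {a..b})" using lim by simp
          show "\<forall>\<^sub>F y in at t within {a..b}.
             norm ((1 / norm (y - t)) *\<^sub>R (R y - (R t + (y - t) *\<^sub>R 0))) \<le> K * \<bar>N y - N t\<bar>"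
            unfolding eventually_at_filter
          proof (intro always_eventually allI impI)
            fix y assume y: "y \<noteq> t" "y \<in> {a..b}"
            show "norm ((1 / norm (y - t)) *\<^sub>R (R y - (R t + (y - t) *\<^sub>R 0))) \<le> K * \<bar>N y - N t\<bar>"
              using Rbound[OF y(2)] y(1) by (simp add: R0 divide_le_eq mult_ac)
          qed
        qed
      qed
    qed
    moreover have "((\<lambda>s. \<xi> s \<bullet> F t) has_vector_derivative \<xi>' t \<bullet> F t) (at t within {a..b})"
      using bounded_linear.has_vector_derivative[OF bounded_linear_inner_left deriv[OF t]] .
    moreover have "(?J has_vector_derivative \<xi>' t \<bullet> F t) (at t within {a..b})"
      by (intro integral_has_vector_derivative continuous_intros cont' contF t)
    moreover have "D = (\<lambda>s. R s + \<xi> s \<bullet> F t - ?I t - ?J s)"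
      by (auto simp: D_def R_def inner_diff_right)
    ultimately show ?thesis
      by (auto intro!: derivative_eq_intros)
  qed
  then obtain c where "\<And>t. t \<in> {a..b} \<Longrightarrow> D t = c"
    using has_vector_derivative_zero_constant[of "{a..b}" D] by auto
  then have "D b = D a" using \<open>a \<le> b\<close> by auto
  moreover have "integral {a..b} (\<lambda>t. \<xi>' t \<bullet> F t + \<xi> t \<bullet> f t) = ?J b + ?I b"
    by (intro Henstock_Kurzweil_Integration.integral_add integrable_continuous_real continuous_intros
        cont' contF set_lebesgue_integral_eq_integral(1)[OF 1])
  ultimately show "integral {a..b} (\<lambda>t. \<xi>' t \<bullet> F t + \<xi> t \<bullet> f t) = \<xi> b \<bullet> F b - \<xi> a \<bullet> F a"
    by (simp add: D_def)
qed

section \<open>The terminal output and the Gramian\<close>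

lemma inner_transpose_mult: "(transpose M *v p) \<bullet> y = p \<bullet> (M *v y)"
  for M :: "real^'n^'m"
  by (simp add: dot_lmul_matrix[symmetric])

text \<open>
  $C e^{A(T-t)}$ sends a state at time \<open>t\<close> to the output at time \<open>T\<close> of the uncontrolled system.
  Reading every state through this map turns the dynamics into a plain integral of the control, and
  reduces the terminal constraint to an equation in the output space.
\<close>

definition terminal_map :: "real^'n^'n \<Rightarrow> real^'n^'p \<Rightarrow> real \<Rightarrow> real \<Rightarrow> real^'n^'p" where
  "terminal_map A C T t = C ** mat_exp ((T - t) *\<^sub>R A)"

lemma terminal_map_T [simp]: "terminal_map A C T T = C"
  by (simp add: terminal_map_def)

lemma terminal_map_has_vector_derivative:
  fixes A :: "real^'n^'n" and C :: "real^'n^'p"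
  shows "(terminal_map A C T has_vector_derivative - (terminal_map A C T t ** A)) (at t within S)"
proof -
  have "((\<lambda>t. mat_exp ((T - t) *\<^sub>R A)) has_vector_derivative - 1 *\<^sub>R (A ** mat_exp ((T - t) *\<^sub>R A)))
      (at t within S)"
    by (rule mat_exp_has_vector_derivative_affine) (auto intro!: derivative_eq_intros)
  from bounded_linear.has_vector_derivative[OF matmul.bounded_linear_right this, of C]
  show ?thesis
    by (simp add: terminal_map_def[abs_def] mat_exp_commute matmul.minus_right matrix_mul_assoc)
qed

lemma continuous_on_terminal_map:
  fixes A :: "real^'n^'n" and C :: "real^'n^'p"
  shows "continuous_on S (terminal_map A C T)"
  unfolding continuous_on_eq_continuous_within
  by (intro ballI has_vector_derivative_continuous[OF terminal_map_has_vector_derivative])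

text \<open>
  $\Phi(t)$: the effect on the output at \<open>T\<close> of a unit impulse of the control at \<open>t\<close>.
  The output Gramian is the integral of $\Phi\Phi^T$.
\<close>

definition impulse_output ::
    "real^'n^'n \<Rightarrow> real^'m^'n \<Rightarrow> real^'n^'p \<Rightarrow> real \<Rightarrow> real \<Rightarrow> real^'m^'p" where
  "impulse_output A B C T t = terminal_map A C T t ** B"

lemma continuous_on_impulse_output:
  fixes A :: "real^'n^'n" and B :: "real^'m^'n" and C :: "real^'n^'p"
  shows "continuous_on S (impulse_output A B C T)"
  unfolding impulse_output_def[abs_def]
  by (intro matmul.continuous_on continuous_on_terminal_map continuous_on_const)

abbreviation gramian_density ::
    "real^'n^'n \<Rightarrow> real^'m^'n \<Rightarrow> real^'n^'p \<Rightarrow> real \<Rightarrow> real \<Rightarrow> real^'p^'p" where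
  "gramian_density A B C T s \<equiv> impulse_output A B C T s ** transpose (impulse_output A B C T s)"

lemma continuous_on_gramian_density:
  fixes A :: "real^'n^'n" and B :: "real^'m^'n" and C :: "real^'n^'p"
  shows "continuous_on S (gramian_density A B C T)"
  by (intro matmul.continuous_on continuous_on_impulse_output
      bounded_linear.continuous_on[OF bounded_linear_transpose])

lemma out_gramian_eq:
  fixes A :: "real^'n^'n" and B :: "real^'m^'n" and C :: "real^'n^'p"
  shows "out_gramian A B C t T = integral {t..T} (gramian_density A B C T)"
  unfolding out_gramian_def impulse_output_def terminal_map_def
  by (simp add: mat_exp_transpose matrix_transpose_mul matrix_mul_assoc)

lemma integral_gramian_density:
  fixes A :: "real^'n^'n" and B :: "real^'m^'n" and C :: "real^'n^'p"
  assumes "t0 \<le> t" "t \<le> T"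
  shows "integral {t0..t} (gramian_density A B C T) = out_gramian A B C t0 T - out_gramian A B C t T"
proof -
  have "integral {t0..t} (gramian_density A B C T) + integral {t..T} (gramian_density A B C T)
      = integral {t0..T} (gramian_density A B C T)"
    by (intro Henstock_Kurzweil_Integration.integral_combine assms integrable_continuous_real
        continuous_on_gramian_density)
  then show ?thesis by (simp add: out_gramian_eq algebra_simps)
qed

lemma out_gramian_has_vector_derivative:
  fixes A :: "real^'n^'n" and B :: "real^'m^'n" and C :: "real^'n^'p"
  assumes "t \<in> {t0..b}" "b \<le> T"
  shows "((\<lambda>t. out_gramian A B C t T) has_vector_derivative - gramian_density A B C T t)
    (at t within {t0..b})"
proof -
  have "((\<lambda>t. out_gramian A B C t0 T - integral {t0..t} (gramian_density A B C T))
      has_vector_derivative 0 - gramian_density A B C T t) (at t within {t0..b})"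
    by (intro has_vector_derivative_diff has_vector_derivative_const
        integral_has_vector_derivative[OF continuous_on_gramian_density assms(1)])
  then have "((\<lambda>t. out_gramian A B C t0 T - integral {t0..t} (gramian_density A B C T))
      has_vector_derivative - gramian_density A B C T t) (at t within {t0..b})"
    by simp
  then show ?thesis
    by (rule has_vector_derivative_transform[OF assms(1), rotated])
       (use assms in \<open>simp add: integral_gramian_density\<close>)
qed

text \<open>
  Variation of constants, read off at the terminal output: $C e^{A(T-t)}x(t)$ has the formal
  derivative $C e^{A(T-t)}Bu(t)$, since the drift $Ax$ is cancelled by the derivative of the exponential.
  Testing against a fixed vector \<open>p\<close> makes this an integration by parts with the adjoint
  solution $\xi(s) = e^{A^T(T-s)}C^Tp$, which covers Caratheodory solutions.
\<close>

lemma terminal_output_has_integral: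
  fixes A :: "real^'n^'n" and B :: "real^'m^'n" and C :: "real^'n^'p"
    and x :: "real \<Rightarrow> real^'n" and u :: "real \<Rightarrow> real^'m"
  assumes "t0 \<le> t"
    and int: "(\<lambda>s. A *v x s + B *v u s) absolutely_integrable_on {t0..t}"
    and x: "\<And>r. r \<in> {t0..t} \<Longrightarrow> x r = x t0 + integral {t0..r} (\<lambda>s. A *v x s + B *v u s)"
  shows "((\<lambda>s. impulse_output A B C T s *v u s) has_integral
      (terminal_map A C T t *v x t - terminal_map A C T t0 *v x t0)) {t0..t}"
proof -
  let ?\<Psi> = "terminal_map A C T" and ?f = "\<lambda>s. A *v x s + B *v u s"
  have "((\<lambda>s. (impulse_output A B C T s *v u s) \<bullet> p) has_integral
      (?\<Psi> t *v x t - ?\<Psi> t0 *v x t0) \<bullet> p) {t0..t}" for p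
  proof -
    define \<xi> where "\<xi> = (\<lambda>s. transpose (?\<Psi> s) *v p)"
    define \<xi>' where "\<xi>' = (\<lambda>s. transpose (- (?\<Psi> s ** A)) *v p)"
    have deriv: "(\<xi> has_vector_derivative \<xi>' s) (at s within {t0..t})" for s
      unfolding \<xi>_def \<xi>'_def
      by (intro bounded_linear.has_vector_derivative[OF matvec.bounded_linear_left]
          bounded_linear.has_vector_derivative[OF bounded_linear_transpose]
          terminal_map_has_vector_derivative)
    have cont': "continuous_on {t0..t} \<xi>'"
      unfolding \<xi>'_def
      by (intro matvec.continuous_on bounded_linear.continuous_on[OF bounded_linear_transpose]
          continuous_on_minus matmul.continuous_on continuous_on_terminal_map continuous_on_const)
    have contx: "continuous_on {t0..t} x"
    proof (rule continuous_on_eq)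
      show "continuous_on {t0..t} (\<lambda>r. x t0 + integral {t0..r} ?f)"
        by (intro continuous_on_add continuous_on_const indefinite_integral_continuous_1
            set_lebesgue_integral_eq_integral(1)[OF int])
    qed (rule x[symmetric])
    note parts = integration_by_parts_inner[OF \<open>t0 \<le> t\<close> deriv cont' int x]
    have "(\<lambda>s. \<xi>' s \<bullet> x s + \<xi> s \<bullet> ?f s) integrable_on {t0..t}"
      by (intro Henstock_Kurzweil_Integration.integrable_add integrable_continuous_real
          continuous_on_inner cont' contx set_lebesgue_integral_eq_integral(1)[OF parts(1)])
    moreover have "\<xi>' s \<bullet> x s + \<xi> s \<bullet> ?f s = (impulse_output A B C T s *v u s) \<bullet> p" for s
      by (simp add: \<xi>_def \<xi>'_def impulse_output_def inner_transpose_mult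
          matvec.add_right inner_add_right matvec.minus_left
          matrix_vector_mul_assoc[symmetric] inner_commute[of p] del: transpose_matrix_vector)
    ultimately show ?thesis
      using parts(2) by (simp add: has_integral_iff \<xi>_def inner_diff_left inner_transpose_mult
          inner_commute[of p] del: transpose_matrix_vector)
  qed
  then show ?thesis
    by (subst has_integral_componentwise_iff) blast
qed

section \<open>Weighted means and the Laplacian\<close>

text \<open>
  The weighted Laplacian subtracts from every agent the common mean with weights \<open>a\<close>. Stating
  this agent by agent avoids Kronecker product algebra from here on.
\<close>

definition deviation :: "real^'a::finite \<Rightarrow> ('a \<Rightarrow> real^'k) \<Rightarrow> 'a \<Rightarrow> real^'k" where
  "deviation a X i = X i - inverse (\<Sum>j\<in>UNIV. a $ j) *\<^sub>R (\<Sum>j\<in>UNIV. a $ j *\<^sub>R X j)"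

lemma sum_weighted_deviation:
  assumes "(\<Sum>j\<in>UNIV. a $ j) \<noteq> 0"
  shows "(\<Sum>i\<in>UNIV. a $ i *\<^sub>R deviation a X i) = 0"
  using assms
  by (simp add: deviation_def scaleR_diff_right sum_subtractf scaleR_sum_left[symmetric]
      del: scaleR_scaleR) (simp add: scaleR_scaleR)

lemma deviation_diff: "deviation a (\<lambda>j. X j - Y j) i = deviation a X i - deviation a Y i"
  by (simp add: deviation_def scaleR_diff_right sum_subtractf)

lemma deviation_eq_self:
  assumes "(\<Sum>j\<in>UNIV. a $ j *\<^sub>R X j) = 0"
  shows "deviation a X i = X i"
  using assms by (simp add: deviation_def)

lemma matrix_deviation:
  fixes K :: "real^'k^'l"
  shows "K *v deviation a X i = deviation a (\<lambda>j. K *v X j) i"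
  by (simp add: deviation_def matrix_vector_mult_diff_distrib matvec.scaleR_right matvec.sum_right)

lemma agent_kron_laplacian:
  fixes x :: "real^('a::finite \<times> 'k::finite)" and K :: "real^'k^'l"
  shows "agent (kron (weighted_laplacian a) K *v x) i = K *v deviation a (agent x) i"
proof -
  have "weighted_laplacian a $ i $ j = (if i = j then 1 else 0) - inverse (\<Sum>k\<in>UNIV. a $ k) * a $ j" for j
    by (simp add: weighted_laplacian_def mat_def matrix_matrix_mult_def columnvector_def rowvector_def)
  then show ?thesis
    by (simp add: agent_kron deviation_def scaleR_diff_left sum_subtractf if_distrib[of "\<lambda>c. c *\<^sub>R _"]
        matrix_vector_mult_diff_distrib matvec.scaleR_right matvec.sum_right scaleR_sum_right
        cong: if_cong)
qed

lemma agent_minus [simp]: "agent (- x) i = - agent x i"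
  by (simp add: agent_def vec_eq_iff)

lemma agent_diff: "agent (x - y) i = agent x i - agent y i"
  by (simp add: agent_def vec_eq_iff)

lemma agent_eqI: "(\<And>i. agent x i = agent y i) \<Longrightarrow> x = y"
  by (metis stack_agent ext)

lemma agent_stacked_output [simp]: "agent (stacked_output C x) i = C *v agent x i"
  by (simp add: stacked_output_def)

lemma bounded_linear_agent: "bounded_linear (\<lambda>x :: real^('a::finite \<times> 'k::finite). agent x i)"
  by (subst linear_conv_bounded_linear[symmetric]) (auto simp: linear_iff agent_def vec_eq_iff)

lemma continuous_on_agentwise:
  fixes u :: "real \<Rightarrow> real^('a::finite \<times> 'k::finite)"
  assumes "\<And>i. continuous_on S (\<lambda>t. agent (u t) i)"
  shows "continuous_on S u"
proof -
  have "continuous_on S (\<lambda>t. \<chi> q. agent (u t) (fst q) $ snd q)"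
    by (intro continuous_on_vec_lambda bounded_linear.continuous_on[OF bounded_linear_vec_nth] assms)
  then show ?thesis by (simp add: agent_def)
qed

section \<open>Trajectories\<close>

lemma trajectory_at_start:
  assumes "trajectory A B t0 x0 S u x" "t0 \<in> S"
  shows "agent (x t0) i = agent x0 i"
  using assms by (simp add: trajectory_def)

lemma trajectory_increments:
  assumes "trajectory A B t0 x0 S u x" "t0 \<le> t" "{t0..t} \<subseteq> S"
  shows "(\<lambda>s. A *v agent (x s) i + B *v agent (u s) i) absolutely_integrable_on {t0..t}"
    and "\<And>r. r \<in> {t0..t} \<Longrightarrow> agent (x r) i =
      agent (x t0) i + integral {t0..r} (\<lambda>s. A *v agent (x s) i + B *v agent (u s) i)"
proof -
  have "t0 \<in> S" "t \<in> S" using assms by auto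
  then show "(\<lambda>s. A *v agent (x s) i + B *v agent (u s) i) absolutely_integrable_on {t0..t}"
    using assms(1) by (simp add: trajectory_def)
  fix r assume "r \<in> {t0..t}"
  then have "r \<in> S" using assms(3) by blast
  then show "agent (x r) i =
      agent (x t0) i + integral {t0..r} (\<lambda>s. A *v agent (x s) i + B *v agent (u s) i)"
    using assms(1) trajectory_at_start[OF assms(1) \<open>t0 \<in> S\<close>] by (simp add: trajectory_def)
qed

lemma trajectory_continuous:
  assumes "trajectory A B t0 x0 S u x" "t0 \<le> t" "{t0..t} \<subseteq> S"
  shows "continuous_on {t0..t} (\<lambda>s. agent (x s) i)"
proof (rule continuous_on_eq)
  note incr = trajectory_increments[OF assms, where i = i]
  show "continuous_on {t0..t} (\<lambda>r. agent (x t0) i +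
      integral {t0..r} (\<lambda>s. A *v agent (x s) i + B *v agent (u s) i))"
    by (intro continuous_on_add continuous_on_const indefinite_integral_continuous_1
        set_lebesgue_integral_eq_integral(1)[OF incr(1)])
  show "\<And>r. r \<in> {t0..t} \<Longrightarrow> agent (x t0) i +
      integral {t0..r} (\<lambda>s. A *v agent (x s) i + B *v agent (u s) i) = agent (x r) i"
    by (rule incr(2)[symmetric])
qed

lemma trajectory_terminal_output:
  fixes C :: "real^'n^'p"
  assumes "trajectory A B t0 x0 S u x" "t0 \<le> t" "{t0..t} \<subseteq> S"
  shows "((\<lambda>s. impulse_output A B C T s *v agent (u s) i) has_integral
      (terminal_map A C T t *v agent (x t) i - terminal_map A C T t0 *v agent x0 i)) {t0..t}"
proof -
  have "t0 \<in> S" using assms by auto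
  show ?thesis
    using terminal_output_has_integral[OF assms(2), of A "\<lambda>s. agent (x s) i" B "\<lambda>s. agent (u s) i" C T,
        OF trajectory_increments[OF assms]]
    by (simp add: trajectory_at_start[OF assms(1) \<open>t0 \<in> S\<close>])
qed

lemma trajectory_cong:
  assumes "\<And>s. s \<in> S \<Longrightarrow> u s = v s" "\<And>t. t \<in> S \<Longrightarrow> {t0..t} \<subseteq> S"
  shows "trajectory A B t0 x0 S u x \<longleftrightarrow> trajectory A B t0 x0 S v x"
proof -
  have *: "((\<lambda>s. A *v agent (x s) i + B *v agent (u s) i) absolutely_integrable_on {t0..t}) =
      ((\<lambda>s. A *v agent (x s) i + B *v agent (v s) i) absolutely_integrable_on {t0..t})"
    "integral {t0..t} (\<lambda>s. A *v agent (x s) i + B *v agent (u s) i) =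
      integral {t0..t} (\<lambda>s. A *v agent (x s) i + B *v agent (v s) i)"
    if "t \<in> S" for t i
  proof -
    have eq: "A *v agent (x s) i + B *v agent (u s) i = A *v agent (x s) i + B *v agent (v s) i"
      if "s \<in> {t0..t}" for s
      using assms that \<open>t \<in> S\<close> by (metis subsetD)
    show "((\<lambda>s. A *v agent (x s) i + B *v agent (u s) i) absolutely_integrable_on {t0..t}) =
      ((\<lambda>s. A *v agent (x s) i + B *v agent (v s) i) absolutely_integrable_on {t0..t})"
      by (intro set_integrable_cong refl eq)
    show "integral {t0..t} (\<lambda>s. A *v agent (x s) i + B *v agent (u s) i) =
      integral {t0..t} (\<lambda>s. A *v agent (x s) i + B *v agent (v s) i)"
      by (intro integral_cong eq)
  qed
  show ?thesis unfolding trajectory_def by (simp add: * cong: ball_cong)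
qed

text \<open>
  The variation of constants formula gives a differentiable, hence Caratheodory, solution when the
  control is continuous; the fundamental theorem of calculus turns the derivative into the integral equation.
\<close>

lemma trajectory_exists:
  fixes A :: "real^'n^'n" and B :: "real^'m^'n"
  assumes cont: "\<And>i. continuous_on {t0..T} (\<lambda>t. agent (u t) i)"
  shows "\<exists>x. trajectory A B t0 x0 {t0..T} u x"
proof -
  define w where "w = (\<lambda>i t. mat_exp ((t0 - t) *\<^sub>R A) *v (B *v agent (u t) i))"
  define x where "x = (\<lambda>t. stack (\<lambda>i. mat_exp ((t - t0) *\<^sub>R A) *v
      (agent x0 i + integral {t0..t} (w i))))"
  have contw: "continuous_on {t0..T} (w i)" for i
    unfolding w_def
    by (intro matvec.continuous_on continuous_on_mat_exp continuous_on_const cont continuous_intros)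
  have deriv: "((\<lambda>t. agent (x t) i) has_vector_derivative
      A *v agent (x t) i + B *v agent (u t) i) (at t within {t0..T})" if t: "t \<in> {t0..T}" for t i
  proof -
    have 1: "((\<lambda>t. mat_exp ((t - t0) *\<^sub>R A)) has_vector_derivative
        1 *\<^sub>R (A ** mat_exp ((t - t0) *\<^sub>R A))) (at t within {t0..T})"
      by (rule mat_exp_has_vector_derivative_affine) (auto intro!: derivative_eq_intros)
    have 2: "((\<lambda>t. agent x0 i + integral {t0..t} (w i)) has_vector_derivative 0 + w i t)
        (at t within {t0..T})"
      by (intro has_vector_derivative_add has_vector_derivative_const
          integral_has_vector_derivative[OF contw t])
    have "mat_exp ((t - t0) *\<^sub>R A) *v w i t = B *v agent (u t) i"
      using mat_exp_add[of "t - t0" "t0 - t" A, symmetric]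
      by (simp add: w_def matrix_vector_mul_assoc matrix_mul_assoc)
    then show ?thesis
      using matvec.has_vector_derivative[OF 1 2]
      by (simp add: x_def matrix_vector_mul_assoc[symmetric] add.commute)
  qed
  have contx: "continuous_on {t0..T} (\<lambda>t. agent (x t) i)" for i
    unfolding continuous_on_eq_continuous_within
    by (intro ballI has_vector_derivative_continuous[OF deriv])
  have contf: "continuous_on {t0..T} (\<lambda>s. A *v agent (x s) i + B *v agent (u s) i)" for i
    by (intro continuous_on_add matvec.continuous_on continuous_on_const contx cont)
  have "trajectory A B t0 x0 {t0..T} u x"
    unfolding trajectory_def
  proof (intro ballI allI conjI)
    fix t i assume t: "t \<in> {t0..T}"
    then have sub: "{t0..t} \<subseteq> {t0..T}" by auto
    show "(\<lambda>s. A *v agent (x s) i + B *v agent (u s) i) absolutely_integrable_on {t0..t}"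
      by (rule absolutely_integrable_continuous_real[OF continuous_on_subset[OF contf sub]])
    have "((\<lambda>s. A *v agent (x s) i + B *v agent (u s) i) has_integral
        (agent (x t) i - agent (x t0) i)) {t0..t}"
      using t sub by (intro fundamental_theorem_of_calculus
          has_vector_derivative_within_subset[OF deriv sub]) auto
    moreover have "agent (x t0) i = agent x0 i" by (simp add: x_def)
    ultimately show "agent (x t) i =
        agent x0 i + integral {t0..t} (\<lambda>s. A *v agent (x s) i + B *v agent (u s) i)"
      by (simp add: integral_unique)
  qed
  then show ?thesis by blast
qed

section \<open>Optimality and uniqueness by orthogonality\<close>

lemma run_cost_diff:
  "run_cost a v = run_cost a u + run_cost a (v - u) +
     2 * (\<Sum>i\<in>UNIV. a $ i * (agent u i \<bullet> (agent v i - agent u i)))"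
  unfolding run_cost_def sum_distrib_left sum.distrib[symmetric]
  by (intro sum.cong refl)
     (simp add: agent_diff inner_diff_left inner_diff_right inner_commute algebra_simps)

lemma run_cost_nonneg: "(\<And>i. 0 < a $ i) \<Longrightarrow> 0 \<le> run_cost a v"
  unfolding run_cost_def by (intro sum_nonneg mult_nonneg_nonneg) (auto simp: less_imp_le)

lemma run_cost_eq_0D:
  assumes "\<And>i. 0 < a $ i" "run_cost a v = 0"
  shows "v = 0"
proof (rule agent_eqI)
  fix i
  have "\<forall>i\<in>UNIV. a $ i * (agent v i \<bullet> agent v i) = 0"
    using assms(2) unfolding run_cost_def
    by (subst (asm) sum_nonneg_eq_0_iff) (auto simp: less_imp_le[OF assms(1)])
  then have "a $ i * (agent v i \<bullet> agent v i) = 0" by blast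
  then have "agent v i = 0"
    using assms(1)[of i] by simp
  then show "agent v i = agent 0 i" by (simp add: agent_def vec_eq_iff)
qed

text \<open>
  The projection theorem in the form needed here. If \<open>u\<close> is orthogonal, in the weighted inner
  product, to every feasible variation $v - u$, then Pythagoras gives
  $J(v) = J(u) + J(v-u)$. This yields optimality, and since $J(v-u) = 0$ forces $v = u$ almost
  everywhere, also uniqueness.
\<close>

lemma the_solution_of_orthogonality:
  assumes a: "\<And>i. 0 < a $ i"
    and u: "feasible A B C a t0 T x0 u"
    and orth: "\<And>v. feasible A B C a t0 T x0 v \<Longrightarrow>
      ((\<lambda>t. \<Sum>i\<in>UNIV. a $ i * (agent (u t) i \<bullet> (agent (v t) i - agent (u t) i))) has_integral 0) {t0..T}"
  shows "the_solution A B C a t0 T x0 u"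
proof -
  have gap: "(\<lambda>t. run_cost a (v t - u t)) absolutely_integrable_on {t0..T}"
    "(LINT t:{t0..T}|lebesgue. run_cost a (v t - u t)) = cost a t0 T v - cost a t0 T u"
    if v: "feasible A B C a t0 T x0 v" for v
  proof -
    have int: "((\<lambda>t. run_cost a (w t)) has_integral cost a t0 T w) {t0..T}"
      if "feasible A B C a t0 T x0 w" for w
    proof -
      have "(\<lambda>t. run_cost a (w t)) absolutely_integrable_on {t0..T}"
        using that by (simp add: feasible_def admissible_def)
      from set_lebesgue_integral_eq_integral[OF this] show ?thesis
        by (simp add: cost_def has_integral_iff)
    qed
    have "((\<lambda>t. run_cost a (v t) - run_cost a (u t) -
        2 * (\<Sum>i\<in>UNIV. a $ i * (agent (u t) i \<bullet> (agent (v t) i - agent (u t) i)))) has_integral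
        cost a t0 T v - cost a t0 T u - 2 * 0) {t0..T}"
      by (intro has_integral_diff int u v has_integral_mult_right orth)
    moreover have "run_cost a (v t) - run_cost a (u t) -
        2 * (\<Sum>i\<in>UNIV. a $ i * (agent (u t) i \<bullet> (agent (v t) i - agent (u t) i)))
        = run_cost a (v t - u t)" for t
      using run_cost_diff[of a "v t" "u t"] by simp
    ultimately have gap: "((\<lambda>t. run_cost a (v t - u t)) has_integral cost a t0 T v - cost a t0 T u) {t0..T}"
      by simp
    then show "(\<lambda>t. run_cost a (v t - u t)) absolutely_integrable_on {t0..T}"
      by (intro nonnegative_absolutely_integrable_1 run_cost_nonneg a) auto
    from set_lebesgue_integral_eq_integral(2)[OF this]
    show "(LINT t:{t0..T}|lebesgue. run_cost a (v t - u t)) = cost a t0 T v - cost a t0 T u"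
      using gap by (simp add: integral_unique)
  qed
  have opt: "optimal A B C a t0 T x0 u"
    unfolding optimal_def
  proof (intro conjI allI impI u)
    fix v assume v: "feasible A B C a t0 T x0 v"
    have "0 \<le> (LINT t:{t0..T}|lebesgue. run_cost a (v t - u t))"
      unfolding set_lebesgue_integral_def
      by (intro Bochner_Integration.integral_nonneg) (auto simp: run_cost_nonneg a)
    then show "cost a t0 T u \<le> cost a t0 T v"
      using gap(2)[OF v] by simp
  qed
  moreover have "AE t in lebesgue_on {t0..T}. v t = u t" if v: "optimal A B C a t0 T x0 v" for v
  proof -
    have fv: "feasible A B C a t0 T x0 v" using v by (simp add: optimal_def)
    have "cost a t0 T v = cost a t0 T u"
      using v opt by (auto simp: optimal_def intro: antisym)
    then have "(LINT t:{t0..T}|lebesgue. run_cost a (v t - u t)) = 0"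
      using gap(2)[OF fv] by simp
    then have "(LINT t|lebesgue_on {t0..T}. run_cost a (v t - u t)) = 0"
      by (simp add: set_lebesgue_integral_def integral_restrict_space)
    moreover have "integrable (lebesgue_on {t0..T}) (\<lambda>t. run_cost a (v t - u t))"
      using gap(1)[OF fv] by (simp add: set_integrable_def integrable_restrict_space)
    ultimately have "AE t in lebesgue_on {t0..T}. run_cost a (v t - u t) = 0"
      using integral_nonneg_eq_0_iff_AE[of "lebesgue_on {t0..T}" "\<lambda>t. run_cost a (v t - u t)"]
      by (simp add: run_cost_nonneg a)
    then show ?thesis
      by (rule AE_mp) (auto intro!: AE_I2 dest: run_cost_eq_0D[OF a])
  qed
  ultimately show ?thesis by (simp add: the_solution_def)
qed

lemma the_solution_cong:
  assumes "t0 \<le> T" and uv: "\<And>t. t \<in> {t0..T} \<Longrightarrow> u t = v t"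
  shows "the_solution A B C a t0 T x0 u \<longleftrightarrow> the_solution A B C a t0 T x0 v"
proof -
  have adm: "admissible a t0 T u \<longleftrightarrow> admissible a t0 T v"
    unfolding admissible_def using uv
    by (intro arg_cong2[of _ _ _ _ "(\<and>)"] measurable_cong set_integrable_cong) auto
  have tr: "trajectory A B t0 x0 {t0..T} u x \<longleftrightarrow> trajectory A B t0 x0 {t0..T} v x" for x
    by (rule trajectory_cong) (auto simp: uv)
  have cst: "cost a t0 T u = cost a t0 T v"
    unfolding cost_def using uv by (intro set_lebesgue_integral_cong) auto
  have feas: "feasible A B C a t0 T x0 u \<longleftrightarrow> feasible A B C a t0 T x0 v"
    unfolding feasible_def by (simp add: adm tr)
  have "(AE t in lebesgue_on {t0..T}. w t = u t) \<longleftrightarrow> (AE t in lebesgue_on {t0..T}. w t = v t)" for w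
    using uv by (intro AE_cong) auto
  then show ?thesis
    by (simp add: the_solution_def optimal_def feas cst)
qed

section \<open>Inverses of matrix-valued functions\<close>

lemma matrix_inv_inverse:
  fixes M :: "real^'p^'p"
  assumes "invertible M"
  shows "M ** matrix_inv M = mat 1" "matrix_inv M ** M = mat 1"
  using someI_ex[OF assms[unfolded invertible_def]] by (simp_all add: matrix_inv_def)

lemma matrix_inv_eqI:
  fixes M :: "real^'p^'p"
  assumes "M ** X = mat 1"
  shows "invertible M" "matrix_inv M = X"
proof -
  show inv: "invertible M"
    using assms invertible_right_inverse by blast
  have "matrix_inv M ** (M ** X) = X"
    by (simp add: matrix_mul_assoc matrix_inv_inverse[OF inv])
  then show "matrix_inv M = X" by (simp add: assms)
qed

text \<open>
  Cramer's rule applied to the columns of the inverse; it shows that the inverse depends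
  continuously on the matrix.
\<close>

lemma matrix_inv_cramer:
  fixes M :: "real^'p^'p"
  assumes "invertible M"
  shows "matrix_inv M = (\<chi> i j. det (\<chi> k l. if l = i then axis j 1 $ k else M $ k $ l) / det M)"
proof -
  have "matrix_inv M $ i $ j * det M = det (\<chi> k l. if l = i then axis j 1 $ k else M $ k $ l)" for i j
  proof -
    have eq: "M *v (matrix_inv M *v axis j 1) = axis j 1"
      by (simp add: matrix_vector_mul_assoc matrix_inv_inverse[OF assms])
    show ?thesis
      using cramer_lemma[of i M "matrix_inv M *v axis j 1"] unfolding eq
      by (simp add: matrix_vector_mult_basis column_def)
  qed
  moreover have "det M \<noteq> 0" using assms invertible_det_nz by blast
  ultimately show ?thesis by (simp add: vec_eq_iff field_simps)
qed

lemma continuous_on_matrix_entry: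
  fixes W :: "real \<Rightarrow> real^'q^'p"
  assumes "continuous_on S W"
  shows "continuous_on S (\<lambda>s. W s $ i $ j)"
  by (intro bounded_linear.continuous_on[OF bounded_linear_vec_nth] assms)

lemma continuous_on_det:
  fixes W :: "real \<Rightarrow> real^'p^'p"
  assumes "\<And>i j. continuous_on S (\<lambda>s. W s $ i $ j)"
  shows "continuous_on S (\<lambda>s. det (W s))"
  unfolding det_def by (intro continuous_intros assms)

lemma continuous_on_matrix_inv:
  fixes W :: "real \<Rightarrow> real^'p^'p"
  assumes W: "continuous_on S W" and inv: "\<And>s. s \<in> S \<Longrightarrow> invertible (W s)"
  shows "continuous_on S (\<lambda>s. matrix_inv (W s))"
proof (rule continuous_on_eq)
  have entry: "continuous_on S (\<lambda>s. (\<chi> k l. if l = i then axis j 1 $ k else W s $ k $ l) $ k $ l)"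
    for i j k l
    by (cases "l = i") (simp_all add: continuous_on_matrix_entry[OF W])
  show "continuous_on S (\<lambda>s. \<chi> i j. det (\<chi> k l. if l = i then axis j 1 $ k else W s $ k $ l) / det (W s))"
    using inv invertible_det_nz
    by (intro continuous_on_vec_lambda continuous_on_divide continuous_on_det entry
        continuous_on_matrix_entry[OF W]) blast
qed (simp add: matrix_inv_cramer inv)

text \<open>
  If $q = W^{-1}e$ and $e' = W'q$, then $Wq' = e' - W'q = 0$. To avoid differentiating the
  inverse, the difference quotient is written as
  $W(s)^{-1}\,(e(s) - W(s)\,q(t))/(s-t)$, where the second factor tends to
  $e' - W'q(t) = 0$ and the inverse is merely continuous.
\<close>

lemma matrix_inv_mult_has_vector_derivative_0:
  fixes W :: "real \<Rightarrow> real^'p^'p" and e :: "real \<Rightarrow> real^'p"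
  assumes inv: "\<And>s. s \<in> S \<Longrightarrow> invertible (W s)" and contW: "continuous_on S W" and t: "t \<in> S"
    and W: "(W has_vector_derivative W') (at t within S)"
    and e: "(e has_vector_derivative W' *v (matrix_inv (W t) *v e t)) (at t within S)"
  shows "((\<lambda>s. matrix_inv (W s) *v e s) has_vector_derivative 0) (at t within S)"
proof -
  define q where "q = matrix_inv (W t) *v e t"
  define g where "g = (\<lambda>s. e s - W s *v q)"
  have "(g has_vector_derivative W' *v q - W' *v q) (at t within S)"
    unfolding g_def
    by (intro has_vector_derivative_diff e[folded q_def]
        bounded_linear.has_vector_derivative[OF matvec.bounded_linear_left W])
  moreover have g0: "g t = 0"
    by (simp add: g_def q_def matrix_vector_mul_assoc matrix_mul_assoc matrix_inv_inverse[OF inv[OF t]])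
  ultimately have "((\<lambda>s. (1 / norm (s - t)) *\<^sub>R g s) \<longlongrightarrow> 0) (at t within S)"
    by (simp add: has_vector_derivative_def has_derivative_within)
  moreover have "((\<lambda>s. matrix_inv (W s)) \<longlongrightarrow> matrix_inv (W t)) (at t within S)"
    using continuous_on_matrix_inv[OF contW inv] t by (simp add: continuous_on_def)
  ultimately have "((\<lambda>s. matrix_inv (W s) *v ((1 / norm (s - t)) *\<^sub>R g s)) \<longlongrightarrow> matrix_inv (W t) *v 0)
      (at t within S)"
    by (intro matvec.tendsto)
  moreover have "\<forall>\<^sub>F s in at t within S. matrix_inv (W s) *v ((1 / norm (s - t)) *\<^sub>R g s) =
      (1 / norm (s - t)) *\<^sub>R (matrix_inv (W s) *v e s - (q + (s - t) *\<^sub>R 0))"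
    unfolding eventually_at_filter
  proof (intro always_eventually allI impI)
    fix s assume "s \<in> S"
    then show "matrix_inv (W s) *v ((1 / norm (s - t)) *\<^sub>R g s) =
      (1 / norm (s - t)) *\<^sub>R (matrix_inv (W s) *v e s - (q + (s - t) *\<^sub>R 0))"
      by (simp add: g_def matvec.scaleR_right matvec.diff_right matrix_vector_mul_assoc
          matrix_inv_inverse[OF inv])
  qed
  (* The summand with the factor 0 is the candidate derivative in the definition of has_derivative. *)
  ultimately have "((\<lambda>s. (1 / norm (s - t)) *\<^sub>R (matrix_inv (W s) *v e s - (q + (s - t) *\<^sub>R 0)))
      \<longlongrightarrow> 0) (at t within S)"
    using tendsto_cong by fastforce
  then show ?thesis
    by (simp add: has_vector_derivative_def has_derivative_within q_def bounded_linear_zero)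
qed

section \<open>The steering vectors and the open-loop solution\<close>

text \<open>
  The Lagrange multiplier of agent \<open>i\<close>: the vector $q_i$ with $W(t,T)\,q_i$ equal to the
  predicted deviation of its terminal output from the weighted mean. Both the open-loop law and the
  state feedback law are $-\Phi(t)^Tq_i$, and differ only in the time at which $q_i$ is
  computed.
\<close>

definition steering ::
    "real^'n^'n \<Rightarrow> real^'m^'n \<Rightarrow> real^'n^'p \<Rightarrow> real^'a \<Rightarrow> real \<Rightarrow> real \<Rightarrow> real^('a::finite \<times> 'n) \<Rightarrow>
     'a \<Rightarrow> real^'p" where
  "steering A B C a T t x i =
     matrix_inv (out_gramian A B C t T) *v deviation a (\<lambda>j. terminal_map A C T t *v agent x j) i"

lemma agent_state_feedback:
  "agent (state_feedback A B C a T x t) i =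
     - (transpose (impulse_output A B C T t) *v steering A B C a T t x i)"
  by (simp add: state_feedback_def agent_kron_laplacian steering_def matrix_deviation[symmetric]
      impulse_output_def terminal_map_def mat_exp_transpose matrix_transpose_mul
      matrix_vector_mul_assoc matrix_mul_assoc del: transpose_matrix_vector)

lemma agent_open_loop_control:
  "agent (open_loop_control A B C a t0 T x0 t) i =
     - (transpose (impulse_output A B C T t) *v steering A B C a T t0 x0 i)"
  by (simp add: open_loop_control_def agent_kron_laplacian steering_def matrix_deviation[symmetric]
      impulse_output_def terminal_map_def mat_exp_transpose matrix_transpose_mul
      matrix_vector_mul_assoc matrix_mul_assoc del: transpose_matrix_vector)

lemma sum_weighted_steering:
  assumes "(\<Sum>j\<in>UNIV. a $ j) \<noteq> 0"
  shows "(\<Sum>i\<in>UNIV. a $ i *\<^sub>R steering A B C a T t x i) = 0"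
proof -
  have "(\<Sum>i\<in>UNIV. a $ i *\<^sub>R steering A B C a T t x i) = matrix_inv (out_gramian A B C t T) *v
      (\<Sum>i\<in>UNIV. a $ i *\<^sub>R deviation a (\<lambda>j. terminal_map A C T t *v agent x j) i)"
    by (simp add: steering_def matvec.sum_right matvec.scaleR_right)
  then show ?thesis by (simp add: sum_weighted_deviation[OF assms])
qed

lemma out_gramian_steering:
  assumes "invertible (out_gramian A B C t T)"
  shows "out_gramian A B C t T *v steering A B C a T t x i =
    deviation a (\<lambda>j. terminal_map A C T t *v agent x j) i"
  by (simp add: steering_def matrix_vector_mul_assoc matrix_mul_assoc matrix_inv_inverse[OF assms])

text \<open>
  Under the open-loop law the predicted terminal outputs move by $-(W(t_0,T) - W(t,T))\,q_i$,
  and the weighted mean does not move because the $q_i$ have weighted sum zero. So the deviations are the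
  remaining Gramian applied to the $q_i$, and vanish at \<open>T\<close>.
\<close>

lemma open_loop_deviation:
  assumes "(\<Sum>j\<in>UNIV. a $ j) \<noteq> 0"
    and tr: "trajectory A B t0 x0 S (open_loop_control A B C a t0 T x0) x"
    and t: "t0 \<le> t" "{t0..t} \<subseteq> S" "t \<le> T"
    and inv: "invertible (out_gramian A B C t0 T)"
  shows "deviation a (\<lambda>j. terminal_map A C T t *v agent (x t) j) i =
    out_gramian A B C t T *v steering A B C a T t0 x0 i"
proof -
  let ?q = "steering A B C a T t0 x0" and ?W = "\<lambda>t. out_gramian A B C t T"
  have "terminal_map A C T t *v agent (x t) j =
      terminal_map A C T t0 *v agent x0 j - (?W t0 - ?W t) *v ?q j" for j
  proof -
    have "((\<lambda>s. gramian_density A B C T s *v ?q j) has_integral (?W t0 - ?W t) *v ?q j) {t0..t}"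
    proof -
      have "(gramian_density A B C T has_integral (?W t0 - ?W t)) {t0..t}"
        unfolding integral_gramian_density[OF t(1,3), symmetric]
        by (intro integrable_integral integrable_continuous_real continuous_on_gramian_density)
      from has_integral_linear[OF this matvec.bounded_linear_left[of "?q j"]]
      show ?thesis by (simp add: o_def)
    qed
    from has_integral_neg[OF this]
    have "((\<lambda>s. impulse_output A B C T s *v agent (open_loop_control A B C a t0 T x0 s) j)
        has_integral - ((?W t0 - ?W t) *v ?q j)) {t0..t}"
      by (simp add: agent_open_loop_control matvec.minus_right matrix_vector_mul_assoc
          del: transpose_matrix_vector)
    from has_integral_unique[OF this trajectory_terminal_output[OF tr t(1,2)]]
    show ?thesis by (simp add: algebra_simps)
  qed
  then have "deviation a (\<lambda>j. terminal_map A C T t *v agent (x t) j) i =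
      deviation a (\<lambda>j. terminal_map A C T t0 *v agent x0 j) i - (?W t0 - ?W t) *v deviation a ?q i"
    by (simp add: deviation_diff matrix_deviation)
  also have "deviation a ?q i = ?q i"
    by (intro deviation_eq_self sum_weighted_steering assms(1))
  finally show ?thesis
    by (simp add: out_gramian_steering[OF inv, symmetric] matvec.diff_left)
qed

lemma continuous_on_open_loop_control:
  fixes x0 :: "real^('a::finite \<times> 'n::finite)"
  shows "continuous_on S (open_loop_control A B C a t0 T x0)"
  by (rule continuous_on_agentwise)
     (unfold agent_open_loop_control, intro continuous_on_minus matvec.continuous_on
        bounded_linear.continuous_on[OF bounded_linear_transpose] continuous_on_impulse_output
        continuous_on_const)

lemma admissible_continuous:
  fixes u :: "real \<Rightarrow> real^('a::finite \<times> 'm::finite)"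
  assumes "continuous_on {t0..T} u"
  shows "admissible a t0 T u"
  unfolding admissible_def
proof
  show "u \<in> borel_measurable (lebesgue_on {t0..T})"
    by (rule continuous_imp_measurable_on_sets_lebesgue[OF assms]) simp
  show "set_integrable lebesgue {t0..T} (\<lambda>t. run_cost a (u t))"
    unfolding run_cost_def
    by (intro absolutely_integrable_continuous_real continuous_on_sum continuous_on_mult
        continuous_on_const continuous_on_inner bounded_linear.continuous_on[OF bounded_linear_agent] assms)
qed

lemma out_gramian_T [simp]: "out_gramian A B C T T = 0"
  by (simp add: out_gramian_def)

lemma open_loop_control_feasible:
  fixes x0 :: "real^('a::finite \<times> 'n::finite)"
  assumes "t0 < T" "(\<Sum>j\<in>UNIV. a $ j) \<noteq> 0" "invertible (out_gramian A B C t0 T)"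
  shows "feasible A B C a t0 T x0 (open_loop_control A B C a t0 T x0)"
proof -
  let ?u = "open_loop_control A B C a t0 T x0"
  have cont: "continuous_on {t0..T} (\<lambda>t. agent (?u t) i)" for i
    by (intro bounded_linear.continuous_on[OF bounded_linear_agent] continuous_on_open_loop_control)
  then obtain x where tr: "trajectory A B t0 x0 {t0..T} ?u x"
    using trajectory_exists[of t0 T ?u] by metis
  have dev: "deviation a (\<lambda>j. C *v agent (x T) j) i = 0" for i
    using open_loop_deviation[OF assms(2) tr _ _ _ assms(3), of T i] assms(1) by simp
  have mean: "C *v agent (x T) i = inverse (\<Sum>j\<in>UNIV. a $ j) *\<^sub>R (\<Sum>j\<in>UNIV. a $ j *\<^sub>R (C *v agent (x T) j))" for i
    using dev[of i] unfolding deviation_def by (simp only: right_minus_eq)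
  have "agent (stacked_output C (x T)) i = agent (stacked_output C (x T)) j" for i j
    unfolding agent_stacked_output using mean[of i] mean[of j] by (rule trans[OF _ sym])
  with tr have "\<exists>x. trajectory A B t0 x0 {t0..T} ?u x \<and>
      (\<forall>i j. i \<noteq> j \<longrightarrow> agent (stacked_output C (x T)) i = agent (stacked_output C (x T)) j)"
    by blast
  then show ?thesis
    unfolding feasible_def
    by (intro conjI admissible_continuous continuous_on_open_loop_control)
qed

text \<open>
  Orthogonality to feasible variations: $\int u_i\cdot(v_i-u_i) = -q_i\cdot\int\Phi(v_i-u_i)$, and the
  last integral is the difference of the terminal outputs of \<open>v\<close> and \<open>u\<close>. For feasible controls this
  difference does not depend on the agent, so the weighted sum is annihilated by
  $\sum_i a_i q_i = 0$.
\<close>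

lemma open_loop_control_solution:
  fixes x0 :: "real^('a::finite \<times> 'n::finite)"
  assumes "t0 < T" and a: "\<And>i. 0 < a $ i" and inv: "invertible (out_gramian A B C t0 T)"
  shows "the_solution A B C a t0 T x0 (open_loop_control A B C a t0 T x0)"
proof (rule the_solution_of_orthogonality[OF a])
  let ?u = "open_loop_control A B C a t0 T x0" and ?q = "steering A B C a T t0 x0"
  have sum_a: "(\<Sum>j\<in>UNIV. a $ j) \<noteq> 0"
    using sum_pos[of UNIV "\<lambda>j. a $ j"] a by force
  show feas: "feasible A B C a t0 T x0 ?u"
    by (rule open_loop_control_feasible[OF assms(1) sum_a inv])
  fix v assume v: "feasible A B C a t0 T x0 v"
  have steered: "\<exists>c. \<forall>i. ((\<lambda>s. impulse_output A B C T s *v agent (w s) i) has_integral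
      (c - terminal_map A C T t0 *v agent x0 i)) {t0..T}"
    if w: "feasible A B C a t0 T x0 w" for w
  proof -
    obtain x where tr: "trajectory A B t0 x0 {t0..T} w x"
      and eq: "\<And>i j. i \<noteq> j \<Longrightarrow> C *v agent (x T) i = C *v agent (x T) j"
      using w unfolding feasible_def agent_stacked_output by blast
    (* An arbitrary agent, here undefined, serves as the reference for the common terminal output. *)
    have "C *v agent (x T) i = C *v agent (x T) undefined" for i
      using eq[of i undefined] by (cases "i = undefined") simp_all
    then obtain z where z: "\<And>i. C *v agent (x T) i = z" by blast
    have "((\<lambda>s. impulse_output A B C T s *v agent (w s) i) has_integral
        (z - terminal_map A C T t0 *v agent x0 i)) {t0..T}" for i
      using trajectory_terminal_output[OF tr, of T C T i] assms(1) by (simp add: z)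
    then show ?thesis by blast
  qed
  obtain c where c: "\<And>i. ((\<lambda>s. impulse_output A B C T s *v agent (?u s) i) has_integral
      (c - terminal_map A C T t0 *v agent x0 i)) {t0..T}"
    using steered[OF feas] by blast
  obtain d where d: "\<And>i. ((\<lambda>s. impulse_output A B C T s *v agent (v s) i) has_integral
      (d - terminal_map A C T t0 *v agent x0 i)) {t0..T}"
    using steered[OF v] by blast
  have "((\<lambda>s. \<Sum>i\<in>UNIV. - (a $ i * (?q i \<bullet> (impulse_output A B C T s *v agent (v s) i -
      impulse_output A B C T s *v agent (?u s) i)))) has_integral
      (\<Sum>i\<in>UNIV. - (a $ i * (?q i \<bullet> ((d - terminal_map A C T t0 *v agent x0 i) -
        (c - terminal_map A C T t0 *v agent x0 i)))))) {t0..T}"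
  proof (intro has_integral_sum has_integral_neg has_integral_mult_right finite)
    fix i
    from has_integral_linear[OF has_integral_diff[OF d[of i] c[of i]] bounded_linear_inner_right[of "?q i"]]
    show "((\<lambda>s. ?q i \<bullet> (impulse_output A B C T s *v agent (v s) i -
        impulse_output A B C T s *v agent (?u s) i)) has_integral
      ?q i \<bullet> ((d - terminal_map A C T t0 *v agent x0 i) - (c - terminal_map A C T t0 *v agent x0 i)))
      {t0..T}"
      by (simp only: o_def)
  qed
  moreover have "(\<Sum>i\<in>UNIV. - (a $ i * (?q i \<bullet> ((d - terminal_map A C T t0 *v agent x0 i) -
        (c - terminal_map A C T t0 *v agent x0 i))))) = 0"
  proof -
    have "(\<Sum>i\<in>UNIV. - (a $ i * (?q i \<bullet> ((d - terminal_map A C T t0 *v agent x0 i) -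
        (c - terminal_map A C T t0 *v agent x0 i))))) =
        - ((\<Sum>i\<in>UNIV. a $ i *\<^sub>R ?q i) \<bullet> (d - c))"
      by (simp add: inner_sum_left sum_negf)
    then show ?thesis by (simp add: sum_weighted_steering[OF sum_a])
  qed
  moreover have "agent (?u s) i \<bullet> (agent (v s) i - agent (?u s) i) =
      - (?q i \<bullet> (impulse_output A B C T s *v agent (v s) i - impulse_output A B C T s *v agent (?u s) i))"
    for s i
    by (subst agent_open_loop_control)
       (simp add: inner_transpose_mult matvec.diff_right del: transpose_matrix_vector)
  ultimately show "((\<lambda>t. \<Sum>i\<in>UNIV. a $ i * (agent (?u t) i \<bullet> (agent (v t) i - agent (?u t) i)))
      has_integral 0) {t0..T}"
    by simp
qed

section \<open>The state feedback\<close>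

lemma feedback_solution_cong:
  assumes "t0 < T" and law: "\<And>x t. t0 \<le> t \<Longrightarrow> t < T \<Longrightarrow> law1 x t = law2 x t"
  shows "feedback_solution A B C a t0 T x0 law1 \<longleftrightarrow> feedback_solution A B C a t0 T x0 law2"
proof -
  have tr: "trajectory A B t0 x0 {t0..<T} (\<lambda>t. law1 (x t) t) x \<longleftrightarrow>
      trajectory A B t0 x0 {t0..<T} (\<lambda>t. law2 (x t) t) x" for x
    by (rule trajectory_cong) (auto simp: law)
  have lim: "((\<lambda>t. law1 (x t) t) \<longlongrightarrow> l) (at_left T) \<longleftrightarrow> ((\<lambda>t. law2 (x t) t) \<longlongrightarrow> l) (at_left T)"
    for x l
  proof (rule tendsto_cong)
    show "\<forall>\<^sub>F t in at_left T. law1 (x t) t = law2 (x t) t"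
      unfolding eventually_at_left_field using assms by (intro exI[of _ t0]) auto
  qed
  have sol: "the_solution A B C a t0 T x0 (\<lambda>t. if t < T then law1 (x t) t else l) \<longleftrightarrow>
      the_solution A B C a t0 T x0 (\<lambda>t. if t < T then law2 (x t) t else l)" for x l
    by (rule the_solution_cong) (use assms in auto)
  show ?thesis
    by (simp add: feedback_solution_def tr lim sol)
qed

lemma open_loop_steering_constant:
  assumes "(\<Sum>j\<in>UNIV. a $ j) \<noteq> 0"
    and tr: "trajectory A B t0 x0 S (open_loop_control A B C a t0 T x0) x"
    and t: "t0 \<le> t" "{t0..t} \<subseteq> S" "t \<le> T"
    and inv: "invertible (out_gramian A B C t0 T)" "invertible (out_gramian A B C t T)"
  shows "steering A B C a T t (x t) i = steering A B C a T t0 x0 i"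
  using open_loop_deviation[OF assms(1-6), of i]
  by (simp add: steering_def[of A B C a T t] matrix_vector_mul_assoc matrix_inv_inverse[OF inv(2)])

text \<open>
  Along \<^emph>\<open>every\<close> closed-loop trajectory the deviations \<open>e\<close> satisfy
  $e' = -\Phi\Phi^T W^{-1}e = W'W^{-1}e$, so the steering vectors $W^{-1}e$ have zero
  derivative. The feedback therefore reproduces the open-loop control, whichever trajectory is taken.
\<close>

lemma closed_loop_steering_constant:
  fixes x0 :: "real^('a::finite \<times> 'n::finite)"
  assumes sum_a: "(\<Sum>j\<in>UNIV. a $ j) \<noteq> 0"
    and tr: "trajectory A B t0 x0 {t0..<T} (\<lambda>t. state_feedback A B C a T (x t) t) x"
    and inv: "\<And>t. t0 \<le> t \<Longrightarrow> t < T \<Longrightarrow> invertible (out_gramian A B C t T)"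
    and t: "t0 \<le> t" "t < T"
  shows "steering A B C a T t (x t) i = steering A B C a T t0 x0 i"
proof -
  let ?\<Psi> = "terminal_map A C T" and ?W = "\<lambda>s. out_gramian A B C s T"
  let ?D = "gramian_density A B C T"
  define q where "q = (\<lambda>j s. steering A B C a T s (x s) j)"
  define e where "e = (\<lambda>j s. deviation a (\<lambda>j. ?\<Psi> s *v agent (x s) j) j)"
  have q_eq: "q j s = matrix_inv (?W s) *v e j s" for j s
    by (simp add: q_def e_def steering_def)
  have sub: "{t0..t} \<subseteq> {t0..<T}" using t by auto
  have contx: "continuous_on {t0..t} (\<lambda>s. agent (x s) j)" for j
    by (rule trajectory_continuous[OF tr t(1) sub])
  have conte: "continuous_on {t0..t} (e j)" for j
    unfolding e_def deviation_def
    by (intro continuous_on_diff continuous_on_scaleR continuous_on_const continuous_on_sum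
        matvec.continuous_on continuous_on_terminal_map contx)
  have W': "(?W has_vector_derivative - ?D s) (at s within {t0..t})" if "s \<in> {t0..t}" for s
    by (rule out_gramian_has_vector_derivative) (use that t in auto)
  have contW: "continuous_on {t0..t} ?W"
    unfolding continuous_on_eq_continuous_within
    by (intro ballI has_vector_derivative_continuous[OF W'])
  have invW: "invertible (?W s)" if "s \<in> {t0..t}" for s
    using that t by (intro inv) auto
  have contq: "continuous_on {t0..t} (q j)" for j
    unfolding q_eq by (intro matvec.continuous_on continuous_on_matrix_inv contW conte invW)
  have contDq: "continuous_on {t0..t} (\<lambda>s. ?D s *v q j s)" for j
    by (intro matvec.continuous_on continuous_on_gramian_density contq)
  have steered: "?\<Psi> s *v agent (x s) j = ?\<Psi> t0 *v agent x0 j - integral {t0..s} (\<lambda>s. ?D s *v q j s)"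
    if s: "s \<in> {t0..t}" for s j
  proof -
    have s': "t0 \<le> s" "{t0..s} \<subseteq> {t0..<T}" using s t by auto
    have "((\<lambda>s. impulse_output A B C T s *v agent (state_feedback A B C a T (x s) s) j) has_integral
        - integral {t0..s} (\<lambda>s. ?D s *v q j s)) {t0..s}"
    proof -
      have "((\<lambda>s. ?D s *v q j s) has_integral integral {t0..s} (\<lambda>s. ?D s *v q j s)) {t0..s}"
        using s by (intro integrable_integral integrable_continuous_real
            continuous_on_subset[OF contDq]) auto
      from has_integral_neg[OF this] show ?thesis
        by (simp add: agent_state_feedback q_def matvec.minus_right matrix_vector_mul_assoc
            del: transpose_matrix_vector)
    qed
    from has_integral_unique[OF this trajectory_terminal_output[OF tr s']]
    show ?thesis by (simp add: algebra_simps)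
  qed
  have e': "(e j has_vector_derivative - ?D s *v q j s) (at s within {t0..t})"
    if s: "s \<in> {t0..t}" for s j
  proof -
    have "((\<lambda>s. ?\<Psi> s *v agent (x s) j) has_vector_derivative 0 - ?D s *v q j s) (at s within {t0..t})" for j
    proof (rule has_vector_derivative_transform[OF s steered])
      show "((\<lambda>s. ?\<Psi> t0 *v agent x0 j - integral {t0..s} (\<lambda>s. ?D s *v q j s)) has_vector_derivative
          0 - ?D s *v q j s) (at s within {t0..t})"
        by (intro has_vector_derivative_diff has_vector_derivative_const
            integral_has_vector_derivative[OF contDq s])
    qed
    then have "(e j has_vector_derivative deviation a (\<lambda>j. 0 - ?D s *v q j s) j) (at s within {t0..t})"
      unfolding e_def deviation_def
      by (intro has_vector_derivative_diff has_vector_derivative_sum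
          bounded_linear.has_vector_derivative[OF bounded_linear_scaleR_right])
    moreover have "deviation a (\<lambda>j. 0 - ?D s *v q j s) j = - ?D s *v q j s"
    proof -
      have "deviation a (\<lambda>j. - ?D s *v q j s) j = - ?D s *v deviation a (\<lambda>j. q j s) j"
        by (rule matrix_deviation[symmetric])
      also have "deviation a (\<lambda>j. q j s) j = q j s"
        unfolding q_def by (intro deviation_eq_self sum_weighted_steering sum_a)
      finally show ?thesis by (simp add: matvec.minus_left)
    qed
    ultimately show ?thesis by simp
  qed
  have "(q i has_vector_derivative 0) (at s within {t0..t})" if s: "s \<in> {t0..t}" for s
    unfolding q_eq
    by (rule matrix_inv_mult_has_vector_derivative_0[OF invW contW s W'[OF s]])
       (use e'[OF s, of i] in \<open>simp_all add: q_eq\<close>)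
  then obtain c where c: "\<And>s. s \<in> {t0..t} \<Longrightarrow> q i s = c"
    using has_vector_derivative_zero_constant[of "{t0..t}" "q i"] by (metis convex_real_interval(5))
  have "q i t = q i t0"
    using c[of t] c[of t0] t by simp
  moreover have "agent (x t0) j = agent x0 j" for j
    using trajectory_at_start[OF tr] t by simp
  ultimately show ?thesis
    by (simp add: q_def steering_def)
qed

text \<open>
  Constancy of the steering vectors is used twice: along the open-loop trajectory it shows that
  this trajectory solves the closed-loop equation, and along an arbitrary closed-loop trajectory it
  shows that the generated control is the open-loop one, whose left limit at \<open>T\<close> exists by
  continuity although $W(t,T)^{-1}$ is unbounded there.
\<close>

lemma state_feedback_solution:
  fixes x0 :: "real^('a::finite \<times> 'n::finite)"
  assumes "t0 < T" and a: "\<And>i. 0 < a $ i"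
    and inv: "\<And>t. t0 \<le> t \<Longrightarrow> t < T \<Longrightarrow> invertible (out_gramian A B C t T)"
  shows "feedback_solution A B C a t0 T x0 (state_feedback A B C a T)"
  unfolding feedback_solution_def
proof (intro conjI allI impI)
  let ?u = "open_loop_control A B C a t0 T x0"
  have sum_a: "(\<Sum>j\<in>UNIV. a $ j) \<noteq> 0"
    using sum_pos[of UNIV "\<lambda>j. a $ j"] a by force
  have same: "state_feedback A B C a T (x t) t = ?u t"
    if "\<And>i. steering A B C a T t (x t) i = steering A B C a T t0 x0 i" for x t
    by (rule agent_eqI) (simp add: agent_state_feedback agent_open_loop_control that)
  have "continuous_on {t0..T} (\<lambda>t. agent (?u t) i)" for i
    by (intro bounded_linear.continuous_on[OF bounded_linear_agent] continuous_on_open_loop_control)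
  then obtain x where "trajectory A B t0 x0 {t0..T} ?u x"
    using trajectory_exists[of t0 T ?u] by metis
  then have x: "trajectory A B t0 x0 {t0..<T} ?u x"
    by (simp add: trajectory_def)
  have "state_feedback A B C a T (x t) t = ?u t" if "t \<in> {t0..<T}" for t
    using that assms(1) by (intro same open_loop_steering_constant[OF sum_a x] inv) auto
  then have "trajectory A B t0 x0 {t0..<T} (\<lambda>t. state_feedback A B C a T (x t) t) x \<longleftrightarrow>
      trajectory A B t0 x0 {t0..<T} ?u x"
    by (intro trajectory_cong) auto
  with x show "\<exists>x. trajectory A B t0 x0 {t0..<T} (\<lambda>t. state_feedback A B C a T (x t) t) x"
    by blast
next
  fix x
  let ?u = "open_loop_control A B C a t0 T x0"
  assume tr: "trajectory A B t0 x0 {t0..<T} (\<lambda>t. state_feedback A B C a T (x t) t) x"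
  have sum_a: "(\<Sum>j\<in>UNIV. a $ j) \<noteq> 0"
    using sum_pos[of UNIV "\<lambda>j. a $ j"] a by force
  have eq: "state_feedback A B C a T (x t) t = ?u t" if "t0 \<le> t" "t < T" for t
    by (rule agent_eqI)
       (simp add: agent_state_feedback agent_open_loop_control
          closed_loop_steering_constant[OF sum_a tr inv that])
  have "(?u \<longlongrightarrow> ?u T) (at_left T)"
    using continuous_on_open_loop_control[of UNIV A B C a t0 T x0]
    by (auto simp: continuous_on_def intro: tendsto_within_subset)
  moreover have "\<forall>\<^sub>F t in at_left T. ?u t = state_feedback A B C a T (x t) t"
    unfolding eventually_at_left_field using assms(1) eq by (intro exI[of _ t0]) auto
  ultimately have "((\<lambda>t. state_feedback A B C a T (x t) t) \<longlongrightarrow> ?u T) (at_left T)"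
    by (rule Lim_transform_eventually)
  moreover have "the_solution A B C a t0 T x0 (\<lambda>t. if t < T then state_feedback A B C a T (x t) t else ?u T)"
  proof -
    have sol: "the_solution A B C a t0 T x0 ?u"
      using assms(1) by (intro open_loop_control_solution a inv) auto
    have switch: "(if t < T then state_feedback A B C a T (x t) t else ?u T) = ?u t" if "t \<in> {t0..T}" for t
      using that eq by auto
    have "the_solution A B C a t0 T x0 (\<lambda>t. if t < T then state_feedback A B C a T (x t) t else ?u T)
        \<longleftrightarrow> the_solution A B C a t0 T x0 ?u"
      using assms(1) by (intro the_solution_cong switch) simp_all
    with sol show ?thesis by blast
  qed
  ultimately show "\<exists>l. ((\<lambda>t. state_feedback A B C a T (x t) t) \<longlongrightarrow> l) (at_left T) \<and>
      the_solution A B C a t0 T x0 (\<lambda>t. if t < T then state_feedback A B C a T (x t) t else l)"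
    by blast
qed

section \<open>Output feedback\<close>

text \<open>
  Nonsingularity of the Gramian makes \<open>C\<close> surjective: a vector annihilated by $C^T$ is annihilated by
  the Gramian. So \<open>C\<close> has a right inverse \<open>R\<close>, and as $x - RCx$ lies in the invariant kernel,
  $CA = (CAR)C$. So the drift of the output depends on the state only through the output.
\<close>

lemma kernel_invariant_factor:
  fixes A :: "real^'n^'n" and B :: "real^'m^'n" and C :: "real^'n^'p"
  assumes inv: "invertible (out_gramian A B C t T)"
    and ker: "(*v) A ` {x. C *v x = 0} \<subseteq> {x. C *v x = 0}"
  obtains A' :: "real^'p^'p" where "C ** A = A' ** C"
proof -
  let ?W = "out_gramian A B C t T"
  have "p = 0" if p: "transpose C *v p = 0" for p
  proof -
    have "?W *v p = integral {t..T} (\<lambda>s. C ** mat_exp ((T - s) *\<^sub>R A) ** B ** transpose B **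
         mat_exp ((T - s) *\<^sub>R transpose A) ** transpose C *v p)"
    proof -
      have "((\<lambda>s. gramian_density A B C T s *v p) has_integral ?W *v p) {t..T}"
        unfolding out_gramian_eq
        using has_integral_linear[OF integrable_integral[OF
            integrable_continuous_real[OF continuous_on_gramian_density]] matvec.bounded_linear_left]
        by (simp add: o_def)
      then have "?W *v p = integral {t..T} (\<lambda>s. gramian_density A B C T s *v p)"
        by (simp add: integral_unique)
      then show ?thesis
        unfolding impulse_output_def terminal_map_def
        by (simp add: mat_exp_transpose matrix_transpose_mul matrix_mul_assoc)
    qed
    also have "\<dots> = 0"
      by (simp add: matrix_vector_mul_assoc[symmetric] p del: transpose_matrix_vector)
    finally have "matrix_inv ?W *v (?W *v p) = 0" by simp
    then show "p = 0" by (simp add: matrix_vector_mul_assoc matrix_inv_inverse[OF inv])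
  qed
  then obtain L where "L ** transpose C = mat 1"
    using matrix_left_invertible_ker by blast
  then have "transpose (L ** transpose C) = mat 1" by simp
  then have CR: "C ** transpose L = mat 1" by (simp add: matrix_transpose_mul)
  have "C ** A = (C ** A ** transpose L) ** C"
  proof (rule matrix_eq[THEN iffD2], rule allI)
    fix x
    have "C *v (x - transpose L *v (C *v x)) = 0"
      by (simp add: matvec.diff_right matrix_vector_mul_assoc matrix_mul_assoc CR
          del: transpose_matrix_vector)
    then have "C *v (A *v (x - transpose L *v (C *v x))) = 0"
      using ker by blast
    then show "(C ** A) *v x = ((C ** A ** transpose L) ** C) *v x"
      by (simp add: matvec.diff_right matrix_vector_mul_assoc matrix_mul_assoc
          del: transpose_matrix_vector)
  qed
  then show thesis by (rule that)
qed

text \<open>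
  With $CA = A'C$ the exponential passes through \<open>C\<close>, and $Ce^{-Ar} = e^{-A'(T-t)}\,Ce^{A(T-t-r)}$.
  The substitution $s = t + r$ then exhibits $G(t,T)$ as congruent to $W(t,T)$.
\<close>

lemma backward_gramian_eq:
  fixes A :: "real^'n^'n" and B :: "real^'m^'n" and C :: "real^'n^'p" and A' :: "real^'p^'p"
    and t T :: real
  assumes "C ** A = A' ** C"
  defines "M \<equiv> mat_exp (- ((T - t) *\<^sub>R A'))"
  shows "backward_gramian A B C t T = M ** out_gramian A B C t T ** transpose (M)"
proof -
  have M: "M = mat_exp ((t - T) *\<^sub>R A')"
    by (simp add: M_def flip: scaleR_minus_left)
  let ?f = "\<lambda>s. M ** gramian_density A B C T s ** transpose (M)"
  have density: "C ** mat_exp (- (r *\<^sub>R A)) ** B ** transpose B ** mat_exp (- (r *\<^sub>R transpose A)) **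
      transpose C = ?f (t + r)" for r
  proof -
    have left: "C ** mat_exp (- (r *\<^sub>R A)) = M ** terminal_map A C T (t + r)"
      using mat_exp_add[of "- (T - t)" "T - (t + r)" A'] mat_exp_intertwine[OF assms(1), of "- r"]
      by (simp add: M terminal_map_def mat_exp_intertwine[OF assms(1)] matrix_mul_assoc)
    have "C ** mat_exp (- (r *\<^sub>R A)) ** B ** transpose B ** mat_exp (- (r *\<^sub>R transpose A)) **
        transpose C = (C ** mat_exp (- (r *\<^sub>R A)) ** B) ** transpose (C ** mat_exp (- (r *\<^sub>R A)) ** B)"
      using mat_exp_transpose[of "- r" A] by (simp add: matrix_transpose_mul matrix_mul_assoc)
    also have "\<dots> = ?f (t + r)"
      unfolding left by (simp add: impulse_output_def matrix_transpose_mul matrix_mul_assoc)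
    finally show ?thesis .
  qed
  have "backward_gramian A B C t T = integral {0..T - t} (?f \<circ> (+) t)"
    unfolding backward_gramian_def density by (simp add: o_def)
  also have "\<dots> = integral {t..T} ?f"
    by (simp add: integral_shift_Icc_real)
  also have "\<dots> = M ** out_gramian A B C t T ** transpose (M)"
  proof -
    have "bounded_linear (\<lambda>X. M ** X ** transpose (M))"
      by (rule bounded_linear_compose[OF matmul.bounded_linear_left matmul.bounded_linear_right])
    from integral_linear[OF integrable_continuous_real[OF continuous_on_gramian_density] this]
    show ?thesis by (simp add: o_def out_gramian_eq)
  qed
  finally show ?thesis .
qed

lemma backward_gramian_inverse:
  fixes A :: "real^'n^'n" and B :: "real^'m^'n" and C :: "real^'n^'p" and A' :: "real^'p^'p"
  assumes "C ** A = A' ** C" and inv: "invertible (out_gramian A B C t T)"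
  defines "N \<equiv> mat_exp ((T - t) *\<^sub>R A')"
  shows "invertible (backward_gramian A B C t T)"
    and "matrix_inv (backward_gramian A B C t T) = transpose N ** matrix_inv (out_gramian A B C t T) ** N"
proof -
  let ?W = "out_gramian A B C t T" and ?M = "mat_exp (- ((T - t) *\<^sub>R A'))"
  have NM: "?M ** N = mat 1" and MN: "N ** ?M = mat 1"
    by (simp_all add: N_def mat_exp_inverse mat_exp_inverse')
  have "transpose ?M ** transpose N = mat 1"
    using MN by (metis matrix_transpose_mul transpose_mat)
  have "backward_gramian A B C t T ** (transpose N ** matrix_inv ?W ** N) =
      ?M ** (?W ** ((transpose ?M ** transpose N) ** (matrix_inv ?W ** N)))"
    by (simp add: backward_gramian_eq[OF assms(1)] matrix_mul_assoc)
  also have "\<dots> = ?M ** ((?W ** matrix_inv ?W) ** N)"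
    unfolding \<open>transpose ?M ** transpose N = mat 1\<close> by (simp add: matrix_mul_assoc)
  also have "\<dots> = mat 1"
    by (simp add: matrix_inv_inverse[OF inv] NM)
  finally have *: "backward_gramian A B C t T ** (transpose N ** matrix_inv ?W ** N) = mat 1" .
  show "invertible (backward_gramian A B C t T)"
    and "matrix_inv (backward_gramian A B C t T) = transpose N ** matrix_inv ?W ** N"
    by (rule matrix_inv_eqI[OF *])+
qed

text \<open>
  Writing $N = e^{A'(T-t)}$, the congruence gives $G^{-1} = N^TW^{-1}N$, while
  $Ce^{A(T-t)} = NC$. So the factors \<open>N\<close> are absorbed and the two laws coincide wherever $W$ is nonsingular.
\<close>

lemma output_feedback_eq_state_feedback:
  fixes A :: "real^'n^'n" and B :: "real^'m^'n" and C :: "real^'n^'p" and A' :: "real^'p^'p"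
  assumes "C ** A = A' ** C" and inv: "invertible (out_gramian A B C t T)"
  shows "output_feedback A B C a T (stacked_output C x) t = state_feedback A B C a T x t"
proof (rule agent_eqI)
  fix i
  let ?N = "mat_exp ((T - t) *\<^sub>R A')" and ?d = "deviation a (\<lambda>j. C *v agent x j) i"
  have \<Psi>: "terminal_map A C T t = ?N ** C"
    by (simp add: terminal_map_def mat_exp_intertwine[OF assms(1)])
  have dev: "agent (stacked_output C x) = (\<lambda>j. C *v agent x j)" by auto
  have "agent (state_feedback A B C a T x t) i =
      - ((transpose (?N ** C ** B) ** matrix_inv (out_gramian A B C t T) ** ?N) *v ?d)"
    by (simp add: agent_state_feedback steering_def impulse_output_def \<Psi>
        matrix_vector_mul_assoc[symmetric] matrix_deviation[of ?N, symmetric] del: transpose_matrix_vector)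
  also have "\<dots> = agent (output_feedback A B C a T (stacked_output C x) t) i"
    by (simp add: output_feedback_def agent_kron_laplacian dev backward_gramian_inverse(2)[OF assms]
        matrix_transpose_mul matrix_mul_assoc del: transpose_matrix_vector)
  finally show "agent (output_feedback A B C a T (stacked_output C x) t) i =
      agent (state_feedback A B C a T x t) i" ..
qed

lemma agent_output_feedback:
  assumes "(\<Sum>k\<in>UNIV. a $ k) \<noteq> 0"
  shows "agent (output_feedback A B C a T y t) i = agent_feedback A B C a T y t i"
proof -
  have "(\<Sum>j\<in>UNIV. (inverse (\<Sum>k\<in>UNIV. a $ k) * a $ j) *\<^sub>R (agent y j - agent y i)) =
      - deviation a (agent y) i"
    using assms
    by (simp add: deviation_def scaleR_diff_right sum_subtractf scaleR_sum_right
        scaleR_sum_left[symmetric] sum_distrib_left[symmetric])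
  then show ?thesis
    by (simp add: agent_feedback_def output_feedback_def agent_kron_laplacian matvec.minus_right)
qed

theorem theorem2:
  fixes A :: "real^'n^'n" and B :: "real^'m^'n" and C :: "real^'n^'p"
    and a :: "real^'a" and t0 T :: real and x0 :: "real^('a \<times> 'n)"
  assumes "t0 < T"
    and "rank B = min CARD('n) CARD('m)"
    and "rank C = min CARD('p) CARD('n)"
    and "out_controllable A B C"
    and "\<And>i. 0 < a $ i"
  shows "the_solution A B C a t0 T x0 (open_loop_control A B C a t0 T x0)
    \<and> feedback_solution A B C a t0 T x0 (state_feedback A B C a T)
    \<and> ((*v) A ` {x. C *v x = 0} \<subseteq> {x. C *v x = 0} \<longrightarrow>
         (\<forall>t\<in>{t0..<T}. invertible (backward_gramian A B C t T))
       \<and> output_feedback_solution A B C a t0 T x0 (output_feedback A B C a T)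
       \<and> output_feedback_solution A B C a t0 T x0
            (\<lambda>y t. stack (agent_feedback A B C a T y t))
       \<and> (\<forall>t\<in>{t0..<T}. \<forall>y i.
            agent (output_feedback A B C a T y t) i = agent_feedback A B C a T y t i))"
proof -
  have inv: "invertible (out_gramian A B C t T)" if "t < T" for t
    using assms(4) that by (simp add: out_controllable_def)
  have sum_a: "(\<Sum>j\<in>UNIV. a $ j) \<noteq> 0"
    using sum_pos[of UNIV "\<lambda>j. a $ j"] assms(5) by force
  have state: "feedback_solution A B C a t0 T x0 (state_feedback A B C a T)"
    by (intro state_feedback_solution assms(1,5) inv)
  have agentwise: "agent (output_feedback A B C a T y t) i = agent_feedback A B C a T y t i" for y t i
    by (rule agent_output_feedback[OF sum_a])
  have stacked: "(\<lambda>y t. stack (agent_feedback A B C a T y t)) = output_feedback A B C a T"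
    by (intro ext agent_eqI) (simp add: agentwise)
  have "(\<forall>t\<in>{t0..<T}. invertible (backward_gramian A B C t T))
      \<and> output_feedback_solution A B C a t0 T x0 (output_feedback A B C a T)"
    if ker: "(*v) A ` {x. C *v x = 0} \<subseteq> {x. C *v x = 0}"
  proof -
    obtain A' :: "real^'p^'p" where A': "C ** A = A' ** C"
      using kernel_invariant_factor[OF inv[OF assms(1)] ker] .
    have "feedback_solution A B C a t0 T x0 (\<lambda>x t. output_feedback A B C a T (stacked_output C x) t)
        \<longleftrightarrow> feedback_solution A B C a t0 T x0 (state_feedback A B C a T)"
      by (rule feedback_solution_cong[OF assms(1)])
         (intro output_feedback_eq_state_feedback[OF A'] inv)
    then show ?thesis
      using state backward_gramian_inverse(1)[OF A' inv]
      by (simp add: output_feedback_solution_def)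
  qed
  then show ?thesis
    using open_loop_control_solution[OF assms(1,5) inv[OF assms(1)]] state
    by (simp add: stacked agentwise)
qed

end
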